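(* Let $L\subset\mathbb{R}^n$ be a convex body containing the origin in its interior. Suppose $f:[0,\infty)\times\mathbb{S}^{n-1}\to[0,\infty)$ is a non-negative function supported on $L$ (that is, on $\{(r,\theta):0\le r\le\rho_L(\theta)\}$) such that for every $\theta\in\mathbb{S}^{n-1}$, $f(t,\theta)$ is concave in $t\in[0,\rho_L(\theta))$. Let $h:[0,\infty)\to[0,\infty)$ be an increasing, non-negative, differentiable function. Let $G:(0,\infty)\times\mathbb{S}^{n-1}\to(0,\infty)$ be a continuous function such that $\int_{(0,R)\times\mathbb{S}^{n-1}}G(r,\theta)\,dr\,d\theta<\infty$ for every $R\in(0,\infty)$. Fix some $\alpha>-1$. The following statements hold. (1) If $G(ur,\cdot)\ge u^\alpha G(r,\cdot)$ for $u\in[0,1]$, $r>0$, then $$\int_{\mathbb{S}^{n-1}}\int_0^{\rho_L(\theta)}h(f(r,\theta))G(r,\theta)\,dr\,d\theta\ \ge\ n\,\beta_\alpha\,\widetilde V_{\mathbb{G}}(L),\qquad(\mathrm{A})$$ where $\beta_\alpha=\inf_{\theta\in\mathbb{S}^{n-1}}\Big[(\alpha+1)\int_0^1h\big(f(0,\theta)\tau\big)(1-\tau)^\alpha\,d\tau\Big]$. There is equality in (A) if, and only if, $G(r,\cdot)$ is homogeneous of degree $\alpha$ in $r$, $f(0,\theta)$ is constant on $\mathbb{S}^{n-1}$, and $f(r,\theta)=f(0,\theta)\big(1-\rho_L(\theta)^{-1}r\big)=f(0,\theta)\,\ell_L(r\theta)$, that is, $f$ is affine on each ray. (2) Suppose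 that $G(ur,\cdot)\le u^\alpha G(r,\cdot)$ for $u\in[0,1]$, $r>0$, and that $\max_{0\le r\le\rho_L(\theta)}f(r,\theta)=f(0,\theta)$ for each $\theta\in\mathbb{S}^{n-1}$. Let $$\Omega_f=\Big\{\theta\in\mathbb{S}^{n-1}:\tfrac{\partial f(r,\theta)}{\partial r}\big|_{r=0^+}=0\Big\},\qquad\beta_b=\sup_{\theta\in\mathbb{S}^{n-1}\setminus\Omega_f}\Big[(\alpha+1)\int_0^1h\big(f(0,\theta)\tau\big)(1-\tau)^\alpha\,d\tau\Big].$$ Then $$\int_{\mathbb{S}^{n-1}}\int_0^{\rho_L(\theta)}h(f(r,\theta))G(r,\theta)\,dr\,d\theta\le\beta_b\int_{\mathbb{S}^{n-1}\setminus\Omega_f}\int_0^{\rho_{\widetilde L}(\theta)}G(r,\theta)\,dr\,d\theta+\int_{\Omega_f}\int_0^{\rho_L(\theta)}h(f(0,\theta))G(r,\theta)\,dr\,d\theta,\qquad(\mathrm{B})$$ where $\rho_{\widetilde L}(\theta)=-\Big(\frac{\partial f(r,\theta)}{\partial r}\big|_{r=0^+}\Big)^{-1}f(0,\theta)$. If $\Omega_f=\emptyset$ and $\frac{\partial f(r,\theta)}{\partial r}\big|_{r=0^+}$ is also continuous for almost all $\theta\in\mathbb{S}^{n-1}$, then $\rho_{\widetilde L}(\theta)$ is the radial function of some star body $\widetilde L$ that contains $L$. In this instance, (B) becomes $$\int_{\mathbb{S}^{n-1}}\int_0^{\rho_L(\theta)}h(f(r,\theta))G(r,\theta)\,dr\,d\theta\le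 n\,\beta_b\,\widetilde V_{\mathbb{G}}(\widetilde L).\qquad(\mathrm{C})$$ There is equality in (B) if, and only if: (i) for $\theta\in\mathbb{S}^{n-1}\setminus\Omega_f$, one has $\rho_{\widetilde L}(\theta)=\rho_L(\theta)$, $f(0,\theta)$ is a constant on $\mathbb{S}^{n-1}$, and $f(r,\theta)=f(0,\theta)\big(1-\rho_L(\theta)^{-1}r\big)=f(0,\theta)\,\ell_L(r\theta)$, that is, $f$ is affine on each ray, and, for every $r>0$, $G(r,\cdot)$ has homogeneity of degree $\alpha$; and (ii) for almost every $\theta\in\Omega_f$, one has $f(r,\theta)=f(0,\theta)$ for every $r\in[0,\rho_L(\theta)]$. If $\Omega_f=\emptyset$, then equality in (C) yields $L=\widetilde L$.
   Context: Radial function: $\rho_L(y)=\sup\{\tau:\tau y\in L\}$. A star body is a compact star-shaped set, with the origin in its interior, with continuous radial function. Roof function: $\ell_L(r\theta)=1-r/\rho_L(\theta)$ for $r\in[0,\rho_L(\theta)]$, and $0$ for $r>\rho_L(\theta)$. $\mathbb{G}(t,\theta)$ is the function with $\partial\mathbb{G}/\partial t=G$ and $\mathbb{G}(0,\theta)=0$, i.e. $\mathbb{G}(t,\theta)=\int_0^tG(r,\theta)\,dr$, and the general dual volume of a star body $L$ is $$\widetilde V_{\mathbb{G}}(L)=\frac1n\int_{\mathbb{S}^{n-1}}\mathbb{G}(\rho_L(\theta),\theta)\,d\theta=\frac1n\int_{\mathbb{S}^{n-1}}\int_0^{\rho_L(\theta)}G(r,\theta)\,dr\,d\theta.$$ "$G(r,\cdot)$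 homogeneous of degree $\alpha$" means $G(ur,\theta)=u^\alpha G(r,\theta)$; inequalities such as $G(ur,\cdot)\ge u^\alpha G(r,\cdot)$ are understood for every $\theta\in\mathbb{S}^{n-1}$ (and $u>0$, so that $G(ur,\cdot)$ is defined). $d\theta$ is spherical Lebesgue measure.
   Formalization: f is Borel. Equality cases: h strictly increasing, conditions on f a.e. and for r<ρ_L, G homogeneous only up to ρ_L (a.e. in (B)), f not a.e. 0 in (A), integral finite and f(0,·) constant only off Ω_f in (B). L̃ is a star body if f(0,·) and the derivative are continuous. *)

theory Defs
  imports "HOL-Analysis.Analysis"
begin

definition radial :: "'a::euclidean_space set \<Rightarrow> 'a \<Rightarrow> real" where
  "radial L y = Sup {\<tau>. \<tau> *\<^sub>R y \<in> L}"

definition star_shaped_at_0 :: "'a::euclidean_space set \<Rightarrow> bool" where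
  "star_shaped_at_0 L \<longleftrightarrow> 0 \<in> L \<and> (\<forall>x\<in>L. closed_segment 0 x \<subseteq> L)"

definition star_body :: "'a::euclidean_space set \<Rightarrow> bool" where
  "star_body L \<longleftrightarrow> compact L \<and> star_shaped_at_0 L \<and> 0 \<in> interior L \<and>
     continuous_on (sphere 0 1) (radial L)"

definition convex_body :: "'a::euclidean_space set \<Rightarrow> bool" where
  "convex_body L \<longleftrightarrow> compact L \<and> convex L \<and> interior L \<noteq> {}"

definition roof :: "'a::euclidean_space set \<Rightarrow> 'a \<Rightarrow> real" where
  "roof L x =
     (if x = 0 then 1
      else if norm x \<le> radial L (sgn x) then 1 - norm x / radial L (sgn x)
      else 0)"

(* Spherical Lebesgue measure, a measure with space "sphere 0 1": by polar coordinates the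
   surface area of A is n times the volume of the cone {r *\<^sub>R \<theta> | 0 < r \<le> 1, \<theta> \<in> A}.
   For x \<noteq> 0, "sgn x" is x / |x|. *)
definition sphere_measure :: "'a::euclidean_space measure" where
  "sphere_measure =
     scale_measure (of_nat DIM('a))
       (distr (restrict_space lborel (cball 0 1 - {0})) (restrict_space borel (sphere 0 1)) sgn)"

(* All integrands are non-negative, so integrals take values in [0,\<infinity>]. *)
definition primitive :: "(real \<Rightarrow> 'a \<Rightarrow> real) \<Rightarrow> real \<Rightarrow> 'a \<Rightarrow> ennreal" where
  "primitive F t \<theta> = (\<integral>\<^sup>+r\<in>{0<..<t}. ennreal (F r \<theta>) \<partial>lborel)"

definition polar_integral ::
    "'a::euclidean_space set \<Rightarrow> ('a \<Rightarrow> real) \<Rightarrow> (real \<Rightarrow> 'a \<Rightarrow> real) \<Rightarrow> ennreal" where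
  "polar_integral A \<rho> F = (\<integral>\<^sup>+\<theta>\<in>A. primitive F (\<rho> \<theta>) \<theta> \<partial>sphere_measure)"

definition gen_dual_volume ::
    "(real \<Rightarrow> 'a \<Rightarrow> real) \<Rightarrow> 'a::euclidean_space set \<Rightarrow> ennreal" where
  "gen_dual_volume G L =
     ennreal (1 / real DIM('a)) * (\<integral>\<^sup>+\<theta>. primitive G (radial L \<theta>) \<theta> \<partial>sphere_measure)"

definition beta_term :: "real \<Rightarrow> (real \<Rightarrow> real) \<Rightarrow> real \<Rightarrow> ennreal" where
  "beta_term \<alpha> h c =
     ennreal (\<alpha> + 1) * (\<integral>\<^sup>+\<tau>\<in>{0<..<1}. ennreal (h (c * \<tau>) * (1 - \<tau>) powr \<alpha>) \<partial>lborel)"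

definition deriv_at_0 :: "(real \<Rightarrow> 'a \<Rightarrow> real) \<Rightarrow> 'a \<Rightarrow> real" where
  "deriv_at_0 f \<theta> = vector_derivative (\<lambda>r. f r \<theta>) (at_right 0)"

definition Omega :: "(real \<Rightarrow> 'a::euclidean_space \<Rightarrow> real) \<Rightarrow> 'a set" where
  "Omega f = {\<theta> \<in> sphere 0 1. deriv_at_0 f \<theta> = 0}"

definition radial_tilde :: "(real \<Rightarrow> 'a \<Rightarrow> real) \<Rightarrow> 'a \<Rightarrow> real" where
  "radial_tilde f \<theta> = - inverse (deriv_at_0 f \<theta>) * f 0 \<theta>"

definition beta_a ::
    "real \<Rightarrow> (real \<Rightarrow> real) \<Rightarrow> (real \<Rightarrow> 'a::euclidean_space \<Rightarrow> real) \<Rightarrow> ennreal" where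
  "beta_a \<alpha> h f = (INF \<theta>\<in>sphere 0 1. beta_term \<alpha> h (f 0 \<theta>))"

definition beta_b ::
    "real \<Rightarrow> (real \<Rightarrow> real) \<Rightarrow> (real \<Rightarrow> 'a::euclidean_space \<Rightarrow> real) \<Rightarrow> ennreal" where
  "beta_b \<alpha> h f = (SUP \<theta>\<in>sphere 0 1 - Omega f. beta_term \<alpha> h (f 0 \<theta>))"

(* Homogeneity of degree \<alpha> in the radial variable, for radii in (0,R].  In the equality cases
   R is the radius of L in direction \<theta>: neither side sees the values of G beyond it (G may equal
   r powr \<alpha> up to R and not after), so equality cannot give more. *)
definition homogeneous_upto :: "(real \<Rightarrow> 'a \<Rightarrow> real) \<Rightarrow> real \<Rightarrow> real \<Rightarrow> 'a \<Rightarrow> bool" where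
  "homogeneous_upto G \<alpha> R \<theta> \<longleftrightarrow>
     (\<forall>r u. 0 < r \<longrightarrow> r \<le> R \<longrightarrow> 0 < u \<longrightarrow> u * r \<le> R \<longrightarrow> G (u * r) \<theta> = u powr \<alpha> * G r \<theta>)"

(* The endpoint r = radial L \<theta> is left out: concavity on [0, radial L \<theta>) says nothing
   about the value of f there. *)
definition affine_on_ray :: "'a::euclidean_space set \<Rightarrow> (real \<Rightarrow> 'a \<Rightarrow> real) \<Rightarrow> 'a \<Rightarrow> bool" where
  "affine_on_ray L f \<theta> \<longleftrightarrow>
     (\<forall>r\<in>{0..<radial L \<theta>}. f r \<theta> = f 0 \<theta> * (1 - inverse (radial L \<theta>) * r) \<and>
                            f r \<theta> = f 0 \<theta> * roof L (r *\<^sub>R \<theta>))"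

(* Modifying f on a null set of directions changes no integral, so f 0 can only be forced to be
   constant almost everywhere.  The constant is the infimum (supremum) because beta_a (beta_b)
   is taken over all directions, null sets included. *)
definition const_ae_inf :: "'a::euclidean_space set \<Rightarrow> ('a \<Rightarrow> real) \<Rightarrow> bool" where
  "const_ae_inf A g \<longleftrightarrow>
     (AE \<theta> in sphere_measure. \<theta> \<in> A \<longrightarrow> ennreal (g \<theta>) = (INF \<phi>\<in>A. ennreal (g \<phi>)))"

definition const_ae_sup :: "'a::euclidean_space set \<Rightarrow> ('a \<Rightarrow> real) \<Rightarrow> bool" where
  "const_ae_sup A g \<longleftrightarrow>
     (AE \<theta> in sphere_measure. \<theta> \<in> A \<longrightarrow> ennreal (g \<theta>) = (SUP \<phi>\<in>A. ennreal (g \<phi>)))"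

end

theory Submission
  imports Defs
begin

text \<open>
Both bounds hold already on each ray and are then integrated over the sphere.  Fix a direction
\<open>\<theta>\<close>, let \<open>R\<close> be the radius of \<open>L\<close> there and let \<open>c = f 0 \<theta>\<close>.  Concavity and non-negativity put
\<open>f\<close> above the roof \<open>c (1 - r / R)\<close>, the chord that descends to \<open>0\<close> at \<open>R\<close>.  If moreover the maximum
of \<open>f\<close> is at \<open>r = 0\<close>, then the tangent at \<open>0\<close> puts \<open>f\<close> below the roof \<open>c (1 - r / T)\<close>, where
\<open>T = radial_tilde f \<theta>\<close> is the zero of the tangent; since \<open>f\<close> stays non-negative up to \<open>R\<close>, necessarily
\<open>T \<ge> R\<close>.  Where the tangent is horizontal, only the trivial bound \<open>f \<le> c\<close> is left.  As \<open>h\<close> is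
increasing, it remains to compare, for a roof over \<open>(0,R)\<close>, the integral of \<open>h (c (1 - r / R)) G r \<theta>\<close>
with that of \<open>G r \<theta>\<close>.

The hypothesis on \<open>G\<close> says that the ratio \<open>G r \<theta> / r powr \<alpha>\<close> decreases in \<open>r\<close> for the lower
bound, and increases for the upper bound, while \<open>h (c (1 - r / R))\<close> always decreases.  Chebyshev's
integral inequality for the measure \<open>r powr \<alpha> dr\<close> therefore compares the mean of their product with
the product of their means (\<open>roof_integral_ge\<close>, \<open>roof_integral_le\<close>), and the mean of
\<open>h (c (1 - r / R))\<close> is \<open>beta_term \<alpha> h c\<close> by the substitution \<open>r = R (1 - \<tau>)\<close>
(\<open>roof_weight_integral\<close>).

The equality cases rest on one principle: two ordered non-negative functions with the same finite
integral agree almost everywhere.  Over the sphere it transfers equality to almost every direction.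
On a ray it gives that \<open>f\<close> is the roof, because \<open>h\<close> is injective and both functions are continuous
inside the ray.  In Chebyshev's inequality, which compares double integrals over pairs \<open>(x, y)\<close>, it
gives that the product of the two increments vanishes for almost every pair; as \<open>h (c (1 - r / R))\<close>
is injective for \<open>c > 0\<close>, the ratio is then constant, which is homogeneity
(\<open>roof_integral_eq_imp_homogeneous\<close>).  In the lower bound, homogeneity extends from almost every to
every direction, since \<open>G\<close> and the radial function are continuous and sets of full measure are dense
in the sphere.
\<close>

section \<open>Chebyshev's integral inequality\<close>

lemma nn_integral_le_eq_imp_AE_eq:
  assumes [measurable]: "f \<in> borel_measurable M" "g \<in> borel_measurable M"
    and le: "AE x in M. f x \<le> g x"
    and eq: "(\<integral>\<^sup>+x. f x \<partial>M) = (\<integral>\<^sup>+x. g x \<partial>M)" and fin: "(\<integral>\<^sup>+x. f x \<partial>M) < \<infinity>"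
  shows "AE x in M. f x = g x"
proof -
  have "AE x in M. g x \<le> f x"
  proof (rule ccontr)
    assume "\<not> (AE x in M. g x \<le> f x)"
    then have "(\<integral>\<^sup>+x. f x \<partial>M) < (\<integral>\<^sup>+x. g x \<partial>M)"
      using fin le by (intro nn_integral_less) auto
    with eq show False by simp
  qed
  with le show ?thesis by eventually_elim auto
qed

text \<open>Expanding \<open>(a x - a y) * (b x - b y)\<close> and separating the terms by sign gives the diagonal part
\<open>a x * b x + a y * b y\<close> and the cross part \<open>a x * b y + a y * b x\<close>.  Comparing their double integrals
against the weight \<open>w\<close> never subtracts, so that Chebyshev's inequality holds in \<open>[0,\<infinity>]\<close>, for any
measure.  The inner integrals are explicit expressions in the outer variable, which makes the iterated integrals
computable one variable at a time.\<close>

context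
  fixes M :: "'b measure" and a b w :: "'b \<Rightarrow> ennreal"
  assumes meas [measurable]: "a \<in> borel_measurable M" "b \<in> borel_measurable M"
    "w \<in> borel_measurable M"
begin

lemma nn_integral_diagonal_inner:
  "(\<integral>\<^sup>+y. (a x * b x + a y * b y) * (w x * w y) \<partial>M) =
    a x * b x * w x * (\<integral>\<^sup>+y. w y \<partial>M) + w x * (\<integral>\<^sup>+y. a y * b y * w y \<partial>M)"
proof -
  have "(\<integral>\<^sup>+y. (a x * b x + a y * b y) * (w x * w y) \<partial>M) =
      (\<integral>\<^sup>+y. a x * b x * w x * w y + w x * (a y * b y * w y) \<partial>M)"
    by (intro nn_integral_cong) (simp add: algebra_simps)
  then show ?thesis by (simp add: nn_integral_add nn_integral_cmult)
qed

lemma nn_integral_cross_inner: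
  "(\<integral>\<^sup>+y. (a x * b y + a y * b x) * (w x * w y) \<partial>M) =
    a x * w x * (\<integral>\<^sup>+y. b y * w y \<partial>M) + b x * w x * (\<integral>\<^sup>+y. a y * w y \<partial>M)"
proof -
  have "(\<integral>\<^sup>+y. (a x * b y + a y * b x) * (w x * w y) \<partial>M) =
      (\<integral>\<^sup>+y. a x * w x * (b y * w y) + b x * w x * (a y * w y) \<partial>M)"
    by (intro nn_integral_cong) (simp add: algebra_simps)
  then show ?thesis by (simp add: nn_integral_add nn_integral_cmult)
qed

lemma nn_integral_diagonal:
  "(\<integral>\<^sup>+x. \<integral>\<^sup>+y. (a x * b x + a y * b y) * (w x * w y) \<partial>M \<partial>M) =
    2 * ((\<integral>\<^sup>+x. a x * b x * w x \<partial>M) * (\<integral>\<^sup>+x. w x \<partial>M))"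
  unfolding nn_integral_diagonal_inner
  by (simp add: nn_integral_add nn_integral_multc) (simp add: algebra_simps mult_2)

lemma nn_integral_cross:
  "(\<integral>\<^sup>+x. \<integral>\<^sup>+y. (a x * b y + a y * b x) * (w x * w y) \<partial>M \<partial>M) =
    2 * ((\<integral>\<^sup>+x. a x * w x \<partial>M) * (\<integral>\<^sup>+x. b x * w x \<partial>M))"
  unfolding nn_integral_cross_inner
  by (simp add: nn_integral_add nn_integral_multc) (simp add: algebra_simps mult_2)

lemma ennreal_two_mult_cancel_le: "2 * x \<le> 2 * y \<longleftrightarrow> x \<le> (y::ennreal)"
  using ennreal_mult_le_mult_iff[of 2 x y] by auto

lemma chebyshev_le:
  assumes "\<And>x y. w x \<noteq> 0 \<Longrightarrow> w y \<noteq> 0 \<Longrightarrow> a x * b x + a y * b y \<le> a x * b y + a y * b x"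
  shows "(\<integral>\<^sup>+x. a x * b x * w x \<partial>M) * (\<integral>\<^sup>+x. w x \<partial>M) \<le> (\<integral>\<^sup>+x. a x * w x \<partial>M) * (\<integral>\<^sup>+x. b x * w x \<partial>M)"
proof -
  have "(\<integral>\<^sup>+x. \<integral>\<^sup>+y. (a x * b x + a y * b y) * (w x * w y) \<partial>M \<partial>M)
      \<le> (\<integral>\<^sup>+x. \<integral>\<^sup>+y. (a x * b y + a y * b x) * (w x * w y) \<partial>M \<partial>M)"
  proof (intro nn_integral_mono)
    fix x y
    show "(a x * b x + a y * b y) * (w x * w y) \<le> (a x * b y + a y * b x) * (w x * w y)"
      using assms[of x y] by (cases "w x = 0 \<or> w y = 0") (auto intro: mult_right_mono)
  qed
  then show ?thesis unfolding nn_integral_diagonal nn_integral_cross ennreal_two_mult_cancel_le .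
qed

lemma chebyshev_ge:
  assumes "\<And>x y. w x \<noteq> 0 \<Longrightarrow> w y \<noteq> 0 \<Longrightarrow> a x * b x + a y * b y \<ge> a x * b y + a y * b x"
  shows "(\<integral>\<^sup>+x. a x * b x * w x \<partial>M) * (\<integral>\<^sup>+x. w x \<partial>M) \<ge> (\<integral>\<^sup>+x. a x * w x \<partial>M) * (\<integral>\<^sup>+x. b x * w x \<partial>M)"
proof -
  have "(\<integral>\<^sup>+x. \<integral>\<^sup>+y. (a x * b x + a y * b y) * (w x * w y) \<partial>M \<partial>M)
      \<ge> (\<integral>\<^sup>+x. \<integral>\<^sup>+y. (a x * b y + a y * b x) * (w x * w y) \<partial>M \<partial>M)"
  proof (intro nn_integral_mono)
    fix x y
    show "(a x * b x + a y * b y) * (w x * w y) \<ge> (a x * b y + a y * b x) * (w x * w y)"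
      using assms[of x y] by (cases "w x = 0 \<or> w y = 0") (auto intro: mult_right_mono)
  qed
  then show ?thesis unfolding nn_integral_diagonal nn_integral_cross ennreal_two_mult_cancel_le .
qed

text \<open>The double integrals of the diagonal and of the cross part agree, so their ordered integrands agree
for almost all pairs; first the outer and then the inner integral is treated in this way.\<close>

lemma chebyshev_eq:
  assumes ord: "(\<forall>x y. w x \<noteq> 0 \<longrightarrow> w y \<noteq> 0 \<longrightarrow> a x * b x + a y * b y \<le> a x * b y + a y * b x) \<or>
                (\<forall>x y. w x \<noteq> 0 \<longrightarrow> w y \<noteq> 0 \<longrightarrow> a x * b x + a y * b y \<ge> a x * b y + a y * b x)"
    and eq: "(\<integral>\<^sup>+x. a x * b x * w x \<partial>M) * (\<integral>\<^sup>+x. w x \<partial>M) = (\<integral>\<^sup>+x. a x * w x \<partial>M) * (\<integral>\<^sup>+x. b x * w x \<partial>M)"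
    and fin: "(\<integral>\<^sup>+x. a x * w x \<partial>M) * (\<integral>\<^sup>+x. b x * w x \<partial>M) < \<infinity>"
    and w_fin: "\<And>x. w x < \<infinity>"
  shows "AE x in M. w x \<noteq> 0 \<longrightarrow> (AE y in M. w y \<noteq> 0 \<longrightarrow> a x * b x + a y * b y = a x * b y + a y * b x)"
proof -
  \<comment> \<open>\<open>P\<close> and \<open>Q\<close> are the diagonal and the cross part, weighted.\<close>
  define P where "P x y = (a x * b x + a y * b y) * (w x * w y)" for x y
  define Q where "Q x y = (a x * b y + a y * b x) * (w x * w y)" for x y
  have [measurable]: "P x \<in> borel_measurable M" "Q x \<in> borel_measurable M" for x
    unfolding P_def Q_def by measurable
  have [measurable]: "(\<lambda>x. \<integral>\<^sup>+y. P x y \<partial>M) \<in> borel_measurable M"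
    "(\<lambda>x. \<integral>\<^sup>+y. Q x y \<partial>M) \<in> borel_measurable M"
    unfolding P_def Q_def nn_integral_diagonal_inner nn_integral_cross_inner by measurable
  have ord': "(\<forall>x y. P x y \<le> Q x y) \<or> (\<forall>x y. Q x y \<le> P x y)"
    using ord
  proof
    assume le: "\<forall>x y. w x \<noteq> 0 \<longrightarrow> w y \<noteq> 0 \<longrightarrow> a x * b x + a y * b y \<le> a x * b y + a y * b x"
    have "P x y \<le> Q x y" for x y unfolding P_def Q_def
      using le[rule_format, of x y] by (cases "w x = 0 \<or> w y = 0") (auto intro: mult_right_mono)
    then show ?thesis by blast
  next
    assume ge: "\<forall>x y. w x \<noteq> 0 \<longrightarrow> w y \<noteq> 0 \<longrightarrow> a x * b x + a y * b y \<ge> a x * b y + a y * b x"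
    have "Q x y \<le> P x y" for x y unfolding P_def Q_def
      using ge[rule_format, of x y] by (cases "w x = 0 \<or> w y = 0") (auto intro: mult_right_mono)
    then show ?thesis by blast
  qed
  have intQ: "(\<integral>\<^sup>+x. \<integral>\<^sup>+y. Q x y \<partial>M \<partial>M) < \<infinity>"
    unfolding Q_def nn_integral_cross using fin by (simp add: ennreal_mult_less_top)
  have eq': "(\<integral>\<^sup>+x. \<integral>\<^sup>+y. P x y \<partial>M \<partial>M) = (\<integral>\<^sup>+x. \<integral>\<^sup>+y. Q x y \<partial>M \<partial>M)"
    unfolding P_def Q_def nn_integral_diagonal nn_integral_cross eq ..
  have outer: "AE x in M. (\<integral>\<^sup>+y. P x y \<partial>M) = (\<integral>\<^sup>+y. Q x y \<partial>M)"
    using ord'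
  proof
    assume "\<forall>x y. P x y \<le> Q x y"
    then show ?thesis using eq' intQ
      by (intro nn_integral_le_eq_imp_AE_eq) (auto intro!: nn_integral_mono)
  next
    assume "\<forall>x y. Q x y \<le> P x y"
    then have "AE x in M. (\<integral>\<^sup>+y. Q x y \<partial>M) = (\<integral>\<^sup>+y. P x y \<partial>M)" using eq' intQ
      by (intro nn_integral_le_eq_imp_AE_eq) (auto intro!: nn_integral_mono)
    then show ?thesis by eventually_elim simp
  qed
  have "AE x in M. (\<integral>\<^sup>+y. Q x y \<partial>M) \<noteq> \<infinity>"
    using intQ by (intro nn_integral_noteq_infinite) (auto simp: less_top)
  with outer show ?thesis
  proof eventually_elim
    case (elim x)
    have "AE y in M. P x y = Q x y"
      using ord'
    proof
      assume "\<forall>x y. P x y \<le> Q x y"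
      then show ?thesis using elim
        by (intro nn_integral_le_eq_imp_AE_eq) (auto simp: less_top)
    next
      assume "\<forall>x y. Q x y \<le> P x y"
      then have "AE y in M. Q x y = P x y" using elim
        by (intro nn_integral_le_eq_imp_AE_eq) (auto simp: less_top)
      then show ?thesis by eventually_elim simp
    qed
    then show ?case
    proof (intro impI, eventually_elim, intro impI)
      fix y assume "P x y = Q x y" "w x \<noteq> 0" "w y \<noteq> 0"
      moreover from this have "w x * w y \<noteq> 0" "w x * w y \<noteq> \<infinity>"
        using w_fin[of x] w_fin[of y] by (auto simp: ennreal_mult_eq_top_iff less_top)
      ultimately show "a x * b x + a y * b y = a x * b y + a y * b x"
        unfolding P_def Q_def
        by (metis ennreal_mult_cancel_left infinity_ennreal_def mult.commute)
    qed
  qed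
qed

end

section \<open>Equality of integrals of continuous functions\<close>

lemma AE_lborel_open_imp:
  fixes U :: "'b::euclidean_space set"
  assumes "AE x in lborel. x \<notin> U" "open U"
  shows "U = {}"
proof -
  have "U \<in> null_sets lborel"
    using assms by (subst AE_iff_null_sets) (auto intro: borel_open)
  then have "negligible U"
    by (simp add: negligible_iff_null_sets null_sets_completionI)
  then show ?thesis using open_not_negligible assms(2) by blast
qed

text \<open>The set where two continuous functions differ is open, hence empty once it is a null set.\<close>

lemma AE_eq_continuous_on_open_imp_eq:
  fixes P Q :: "'b::euclidean_space \<Rightarrow> real"
  assumes "open D" "continuous_on D P" "continuous_on D Q"
    and "AE x in lborel. x \<in> D \<longrightarrow> P x = Q x" "x \<in> D"
  shows "P x = Q x"
proof -
  have "open (D \<inter> (\<lambda>x. P x - Q x) -` (- {0}))"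
    using assms by (intro continuous_open_preimage continuous_intros) auto
  moreover have "AE x in lborel. x \<notin> D \<inter> (\<lambda>x. P x - Q x) -` (- {0})"
    using assms(4) by eventually_elim auto
  ultimately have "D \<inter> (\<lambda>x. P x - Q x) -` (- {0}) = {}" by (intro AE_lborel_open_imp)
  with assms(5) show ?thesis by auto
qed

lemma borel_measurable_ennreal_indicator:
  assumes "continuous_on A f" "A \<in> sets borel"
  shows "(\<lambda>x. ennreal (f x) * indicator A x) \<in> borel_measurable borel"
proof -
  have "(\<lambda>x. ennreal (indicator A x *\<^sub>R f x)) \<in> borel_measurable borel"
    using borel_measurable_continuous_on_indicator[OF assms(2,1)] by measurable
  also have "(\<lambda>x. ennreal (indicator A x *\<^sub>R f x)) = (\<lambda>x. ennreal (f x) * indicator A x)"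
    by (auto simp: indicator_def)
  finally show ?thesis .
qed

lemma nn_integral_eq_continuous_on_open_imp_eq:
  fixes P Q :: "'b::euclidean_space \<Rightarrow> real"
  assumes D: "open D" and cont: "continuous_on D P" "continuous_on D Q"
    and le: "\<And>x. x \<in> D \<Longrightarrow> 0 \<le> P x" "\<And>x. x \<in> D \<Longrightarrow> P x \<le> Q x"
    and eq: "(\<integral>\<^sup>+x\<in>D. ennreal (P x) \<partial>lborel) = (\<integral>\<^sup>+x\<in>D. ennreal (Q x) \<partial>lborel)"
    and fin: "(\<integral>\<^sup>+x\<in>D. ennreal (P x) \<partial>lborel) < \<infinity>" and x: "x \<in> D"
  shows "P x = Q x"
proof -
  have "AE x in lborel. ennreal (P x) * indicator D x = ennreal (Q x) * indicator D x"
  proof (rule nn_integral_le_eq_imp_AE_eq[OF _ _ _ eq fin])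
    show "AE x in lborel. ennreal (P x) * indicator D x \<le> ennreal (Q x) * indicator D x"
      using le(2) by (auto simp: indicator_def intro!: ennreal_leI)
  qed (simp_all add: borel_measurable_ennreal_indicator cont D)
  then have "AE x in lborel. x \<in> D \<longrightarrow> P x = Q x"
  proof eventually_elim
    case (elim x) then show ?case using le[of x] by auto
  qed
  then show ?thesis using AE_eq_continuous_on_open_imp_eq[OF D cont _ x] by blast
qed

section \<open>The weight of homogeneity degree \<open>\<alpha>\<close> and the constant \<open>beta_term\<close>\<close>

lemma nn_integral_powr_from_0:
  assumes "\<alpha> > -1" "R > 0"
  shows "(\<integral>\<^sup>+r\<in>{0<..<R}. ennreal (r powr \<alpha>) \<partial>lborel) = ennreal (R powr (\<alpha> + 1) / (\<alpha> + 1))"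
proof -
  have "((\<lambda>x. x powr \<alpha>) has_integral (R powr (\<alpha> + 1) / (\<alpha> + 1))) {0..R}"
    using assms by (intro has_integral_powr_from_0) auto
  then have "((\<lambda>x. x powr \<alpha>) has_integral (R powr (\<alpha> + 1) / (\<alpha> + 1))) {0<..<R}"
    by (simp add: has_integral_Icc_iff_Ioo)
  from nn_integral_has_integral_lebesgue'[OF _ this] show ?thesis by simp
qed

text \<open>This carries the sign of \<open>(p - q) * (s - t)\<close> over to \<open>[0,\<infinity>]\<close>, in the subtraction-free form in which
Chebyshev's inequality uses it.\<close>

lemma ennreal_rearrangement:
  assumes "p \<ge> 0" "q \<ge> 0" "s \<ge> 0" "t \<ge> 0"
  shows "ennreal p * ennreal s + ennreal q * ennreal t \<le> ennreal p * ennreal t + ennreal q * ennreal s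
      \<longleftrightarrow> (p - q) * (s - t) \<le> 0"
    and "ennreal p * ennreal t + ennreal q * ennreal s \<le> ennreal p * ennreal s + ennreal q * ennreal t
      \<longleftrightarrow> 0 \<le> (p - q) * (s - t)"
    and "ennreal p * ennreal s + ennreal q * ennreal t = ennreal p * ennreal t + ennreal q * ennreal s
      \<longleftrightarrow> (p - q) * (s - t) = 0"
proof -
  have "ennreal p * ennreal s + ennreal q * ennreal t = ennreal (p * s + q * t)"
    "ennreal p * ennreal t + ennreal q * ennreal s = ennreal (p * t + q * s)"
    using assms by (simp_all add: ennreal_mult' ennreal_plus)
  moreover have "(p - q) * (s - t) = (p * s + q * t) - (p * t + q * s)"
    by (simp add: algebra_simps)
  ultimately show
    "ennreal p * ennreal s + ennreal q * ennreal t \<le> ennreal p * ennreal t + ennreal q * ennreal s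
      \<longleftrightarrow> (p - q) * (s - t) \<le> 0"
    "ennreal p * ennreal t + ennreal q * ennreal s \<le> ennreal p * ennreal s + ennreal q * ennreal t
      \<longleftrightarrow> 0 \<le> (p - q) * (s - t)"
    "ennreal p * ennreal s + ennreal q * ennreal t = ennreal p * ennreal t + ennreal q * ennreal s
      \<longleftrightarrow> (p - q) * (s - t) = 0"
    using assms by (simp_all add: ennreal_le_iff ennreal_inj del: ennreal_plus)
qed

locale monotone_profile =
  fixes h :: "real \<Rightarrow> real" and \<alpha> :: real
  assumes \<alpha>: "-1 < \<alpha>"
    and h_mono: "mono_on {0..} h"
    and h_nonneg: "\<And>x. x \<ge> 0 \<Longrightarrow> h x \<ge> 0"
    and h_cont: "continuous_on {0..} h"
begin

lemma h_le: "0 \<le> x \<Longrightarrow> x \<le> y \<Longrightarrow> h x \<le> h y"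
  using h_mono by (auto simp: mono_on_def)

lemma continuous_on_h_compose:
  assumes "continuous_on A p" "\<And>x. x \<in> A \<Longrightarrow> p x \<ge> 0"
  shows "continuous_on A (\<lambda>x. h (p x))"
  by (rule continuous_on_compose2[OF h_cont]) (use assms in auto)

abbreviation weight_mass :: "real \<Rightarrow> ennreal" where
  "weight_mass R \<equiv> ennreal (R powr (\<alpha> + 1) / (\<alpha> + 1))"

lemma weight_mass_cancel:
  assumes "R > 0"
  shows "weight_mass R \<noteq> 0" "weight_mass R \<noteq> top"
  using assms \<alpha> by simp_all

text \<open>The substitution \<open>r = R * (1 - \<tau>)\<close> turns the roof over \<open>(0,R)\<close> into the identity and pulls out the
factor \<open>R powr (\<alpha> + 1)\<close>.  Thus \<open>beta_term \<alpha> h c\<close> is the mean of \<open>h (c * (1 - r / R))\<close> over \<open>(0,R)\<close> for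
the weight \<open>r powr \<alpha>\<close>, whatever \<open>R\<close> is.\<close>

lemma roof_weight_integral:
  assumes R: "R > 0" and c: "c \<ge> 0"
  shows "(\<integral>\<^sup>+r\<in>{0<..<R}. ennreal (h (c * (1 - r / R)) * r powr \<alpha>) \<partial>lborel) =
    beta_term \<alpha> h c * weight_mass R"
proof -
  define F where "F r = ennreal (h (c * (1 - r / R)) * r powr \<alpha>) * indicator {0<..<R} r" for r
  have [measurable]: "F \<in> borel_measurable borel"
    unfolding F_def using R c
    by (intro borel_measurable_ennreal_indicator continuous_intros continuous_on_h_compose)
      auto
  have [measurable]: "(\<lambda>\<tau>. ennreal (h (c * \<tau>) * (1 - \<tau>) powr \<alpha>) * indicator {0<..<1} \<tau>) \<in> borel_measurable borel"
    using c by (intro borel_measurable_ennreal_indicator continuous_intros continuous_on_h_compose)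
      auto
  have "(\<integral>\<^sup>+r. F r \<partial>lborel) = ennreal R * (\<integral>\<^sup>+\<tau>. F (R + (- R) * \<tau>) \<partial>lborel)"
    using nn_integral_real_affine[of F "- R" R] R by simp
  also have "(\<integral>\<^sup>+\<tau>. F (R + (- R) * \<tau>) \<partial>lborel) =
      (\<integral>\<^sup>+\<tau>. ennreal (R powr \<alpha>) * (ennreal (h (c * \<tau>) * (1 - \<tau>) powr \<alpha>) * indicator {0<..<1} \<tau>) \<partial>lborel)"
  proof (intro nn_integral_cong)
    fix \<tau> :: real
    have "R + - R * \<tau> = R * (1 - \<tau>)" by (simp add: algebra_simps)
    moreover have "R * (1 - \<tau>) \<in> {0<..<R} \<longleftrightarrow> \<tau> \<in> {0<..<1}"
      using R by (auto simp: zero_less_mult_iff)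
    moreover have "ennreal (h (c * \<tau>) * (R * (1 - \<tau>)) powr \<alpha>) =
        ennreal (R powr \<alpha>) * ennreal (h (c * \<tau>) * (1 - \<tau>) powr \<alpha>)" if "\<tau> \<in> {0<..<1}"
      using that R c h_nonneg[of "c * \<tau>"] by (simp add: powr_mult ennreal_mult[symmetric] mult_ac)
    ultimately show "F (R + (- R) * \<tau>) =
        ennreal (R powr \<alpha>) * (ennreal (h (c * \<tau>) * (1 - \<tau>) powr \<alpha>) * indicator {0<..<1} \<tau>)"
      using R unfolding F_def by (auto simp: indicator_def)
  qed
  also have "\<dots> = ennreal (R powr \<alpha>) * (\<integral>\<^sup>+\<tau>\<in>{0<..<1}. ennreal (h (c * \<tau>) * (1 - \<tau>) powr \<alpha>) \<partial>lborel)"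
    by (rule nn_integral_cmult) simp
  finally have "(\<integral>\<^sup>+r. F r \<partial>lborel) = ennreal R * (ennreal (R powr \<alpha>) *
      (\<integral>\<^sup>+\<tau>\<in>{0<..<1}. ennreal (h (c * \<tau>) * (1 - \<tau>) powr \<alpha>) \<partial>lborel))" .
  moreover have "ennreal R * ennreal (R powr \<alpha>) = ennreal (\<alpha> + 1) * ennreal (R powr (\<alpha> + 1) / (\<alpha> + 1))"
    using R \<alpha> by (simp add: ennreal_mult[symmetric] powr_add mult_ac)
  ultimately show ?thesis
    unfolding F_def beta_term_def by (simp add: mult_ac) (simp add: mult.assoc[symmetric])
qed

lemma beta_term_mono:
  assumes "0 \<le> c" "c \<le> d"
  shows "beta_term \<alpha> h c \<le> beta_term \<alpha> h d"
  unfolding beta_term_def using assms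
  by (intro mult_left_mono nn_integral_mono)
    (auto simp: indicator_def intro!: ennreal_leI mult_right_mono h_le)

text \<open>A mean of \<open>h (c * \<tau>)\<close> is at most \<open>h c\<close>; \<open>\<alpha> > -1\<close> makes the total weight finite.\<close>

lemma beta_term_finite:
  assumes "0 \<le> c"
  shows "beta_term \<alpha> h c < top"
proof -
  have "beta_term \<alpha> h c * weight_mass 1
      \<le> (\<integral>\<^sup>+r. ennreal (h c) * (ennreal (r powr \<alpha>) * indicator {0<..<1} r) \<partial>lborel)"
    unfolding roof_weight_integral[OF zero_less_one assms, symmetric]
    using assms by (intro nn_integral_mono)
      (auto simp: indicator_def ennreal_mult'[symmetric] h_nonneg mult_left_le
        intro!: ennreal_leI mult_right_mono h_le)
  also have "\<dots> = ennreal (h c) * weight_mass 1"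
    using nn_integral_powr_from_0[OF \<alpha>, of 1]
    by (subst nn_integral_cmult) (auto intro!: borel_measurable_ennreal_indicator continuous_intros)
  also have "\<dots> < top" by (simp add: ennreal_mult_less_top)
  finally have "beta_term \<alpha> h c * weight_mass 1 < top" .
  then show ?thesis
    using weight_mass_cancel[of 1] by (auto simp: ennreal_mult_less_top)
qed

text \<open>If two means were equal, then so would be the two continuous ordered integrands at every point,
for instance at \<open>r = 1/2\<close>.\<close>

lemma beta_term_strict_mono:
  assumes h: "strict_mono_on {0..} h" and cd: "0 \<le> c" "c < d"
  shows "beta_term \<alpha> h c < beta_term \<alpha> h d"
proof (rule ccontr)
  assume "\<not> ?thesis"
  with beta_term_mono[of c d] cd have "beta_term \<alpha> h c = beta_term \<alpha> h d" by auto
  then have eq: "(\<integral>\<^sup>+r\<in>{0<..<1}. ennreal (h (c * (1 - r / 1)) * r powr \<alpha>) \<partial>lborel)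
      = (\<integral>\<^sup>+r\<in>{0<..<1}. ennreal (h (d * (1 - r / 1)) * r powr \<alpha>) \<partial>lborel)"
    using cd by (simp only: roof_weight_integral[OF zero_less_one])
  have "h (c * (1 - 1/2 / 1)) * (1/2) powr \<alpha> = h (d * (1 - 1/2 / 1)) * (1/2) powr \<alpha>"
  proof (rule nn_integral_eq_continuous_on_open_imp_eq[where D = "{0<..<1::real}", OF _ _ _ _ _ eq])
    show "(\<integral>\<^sup>+r\<in>{0<..<1}. ennreal (h (c * (1 - r / 1)) * r powr \<alpha>) \<partial>lborel) < \<infinity>"
      unfolding roof_weight_integral[OF zero_less_one cd(1)]
      using beta_term_finite[OF cd(1)] by (simp add: ennreal_mult_less_top)
  qed (use cd in \<open>auto intro!: continuous_intros continuous_on_h_compose mult_right_mono h_le mult_nonneg_nonneg h_nonneg\<close>)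
  then have "h (c / 2) = h (d / 2)" by simp
  moreover have "h (c / 2) < h (d / 2)"
    using h cd by (auto simp: strict_mono_on_def)
  ultimately show False by simp
qed

end

section \<open>Roofs integrated against a density\<close>

lemma primitive_mono: "(R::real) \<le> T \<Longrightarrow> primitive G R \<theta> \<le> primitive G T \<theta>"
  unfolding primitive_def by (intro nn_integral_mono) (auto simp: indicator_def)

locale weighted_ray = monotone_profile +
  fixes G :: "real \<Rightarrow> 'a \<Rightarrow> real" and \<theta> :: 'a
  assumes G_pos: "\<And>r. r > 0 \<Longrightarrow> G r \<theta> > 0"
    and G_cont: "continuous_on {0<..} (\<lambda>r. G r \<theta>)"
begin

text \<open>For \<open>0 < u \<le> 1\<close>, the condition \<open>G (u * r) \<theta> \<ge> u powr \<alpha> * G r \<theta>\<close> says that this ratio decreases in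
\<open>r\<close>, the reverse condition that it increases, and homogeneity that it is constant.\<close>

abbreviation ratio :: "real \<Rightarrow> real" where
  "ratio r \<equiv> G r \<theta> / r powr \<alpha>"

abbreviation roof_integral :: "real \<Rightarrow> real \<Rightarrow> ennreal" where
  "roof_integral R c \<equiv> (\<integral>\<^sup>+r\<in>{0<..<R}. ennreal (h (c * (1 - r / R)) * G r \<theta>) \<partial>lborel)"

lemma primitive_pos:
  assumes "R > 0" shows "primitive G R \<theta> > 0"
proof (rule ccontr)
  assume "\<not> ?thesis"
  then have "(\<integral>\<^sup>+r. ennreal (G r \<theta>) * indicator {0<..<R} r \<partial>lborel) = 0"
    by (simp add: primitive_def)
  moreover have "continuous_on {0<..<R} (\<lambda>r. G r \<theta>)"
    by (rule continuous_on_subset[OF G_cont]) auto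
  then have "(\<lambda>r. ennreal (G r \<theta>) * indicator {0<..<R} r) \<in> borel_measurable lborel"
    by (simp add: borel_measurable_ennreal_indicator)
  ultimately have "AE r in lborel. ennreal (G r \<theta>) * indicator {0<..<R} r = 0"
    by (simp add: nn_integral_0_iff_AE)
  then have "AE r in lborel. r \<notin> {0<..<R}"
  proof eventually_elim
    case (elim r)
    then show ?case using G_pos[of r] by (auto simp: indicator_def ennreal_eq_0_iff)
  qed
  then have "{0<..<R} = {}" by (rule AE_lborel_open_imp) simp
  then show False using assms by simp
qed

lemma ratio_antimono:
  assumes "\<And>r u. r > 0 \<Longrightarrow> 0 < u \<Longrightarrow> u \<le> 1 \<Longrightarrow> G (u * r) \<theta> \<ge> u powr \<alpha> * G r \<theta>"
    and "0 < x" "x \<le> y"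
  shows "ratio y \<le> ratio x"
  using assms(1)[of y "x / y"] assms(2,3)
  by (simp add: powr_divide field_simps)

lemma ratio_mono:
  assumes "\<And>r u. r > 0 \<Longrightarrow> 0 < u \<Longrightarrow> u \<le> 1 \<Longrightarrow> G (u * r) \<theta> \<le> u powr \<alpha> * G r \<theta>"
    and "0 < x" "x \<le> y"
  shows "ratio x \<le> ratio y"
  using assms(1)[of y "x / y"] assms(2,3)
  by (simp add: powr_divide field_simps)

lemma roof_order:
  assumes "R > 0" "c \<ge> 0" "0 < x" "x \<le> y" "y < R"
  shows "h (c * (1 - y / R)) \<le> h (c * (1 - x / R))"
  using assms by (intro h_le mult_nonneg_nonneg mult_left_mono) (auto simp: field_simps)

context
  fixes R c :: real
  assumes R: "R > 0" and c: "c \<ge> 0"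
begin

text \<open>
The ingredients of Chebyshev's inequality: \<open>a\<close> is the increasing function \<open>h\<close> of the roof, \<open>b\<close> is the
ratio of the density to the weight and \<open>w\<close> is the weight.  The cut-off at \<open>0\<close> keeps the argument
of \<open>h\<close> in its domain for all \<open>r\<close> and so makes \<open>a\<close> measurable on the whole line.\<close>

private definition "a r = ennreal (h (c * max 0 (1 - r / R)))" for r
private definition "b r = ennreal (ratio r) * indicator {0<..<R} r" for r
private definition "w r = ennreal (r powr \<alpha>) * indicator {0<..<R} r" for r

private lemma meas [measurable]:
  "a \<in> borel_measurable lborel" "b \<in> borel_measurable lborel" "w \<in> borel_measurable lborel"
proof -
  have "continuous_on UNIV (\<lambda>r. h (c * max 0 (1 - r / R)))"
    using c R by (intro continuous_on_h_compose continuous_intros) auto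
  then have "(\<lambda>r. h (c * max 0 (1 - r / R))) \<in> borel_measurable borel"
    by (rule borel_measurable_continuous_onI)
  then show "a \<in> borel_measurable lborel" unfolding a_def by simp
  have "continuous_on {0<..<R} ratio"
    by (intro continuous_intros continuous_on_subset[OF G_cont]) auto
  then show "b \<in> borel_measurable lborel"
    unfolding b_def by (simp add: borel_measurable_ennreal_indicator)
  have "continuous_on {0<..<R} (\<lambda>r. r powr \<alpha>)"
    by (intro continuous_intros) auto
  then show "w \<in> borel_measurable lborel"
    unfolding w_def by (simp add: borel_measurable_ennreal_indicator)
qed

private lemma integrals:
  "(\<integral>\<^sup>+r. a r * b r * w r \<partial>lborel) = roof_integral R c"
  "(\<integral>\<^sup>+r. w r \<partial>lborel) = weight_mass R"
  "(\<integral>\<^sup>+r. a r * w r \<partial>lborel) = beta_term \<alpha> h c * weight_mass R"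
  "(\<integral>\<^sup>+r. b r * w r \<partial>lborel) = primitive G R \<theta>"
proof -
  have hn: "h (c * max 0 (1 - r / R)) \<ge> 0" for r using c by (intro h_nonneg) auto
  have m: "max 0 (1 - r / R) = 1 - r / R" if "r \<in> {0<..<R}" for r using that R by auto
  have rn: "ratio r \<ge> 0" if "r \<in> {0<..<R}" for r using G_pos[of r] that by simp
  have G: "ratio r * r powr \<alpha> = G r \<theta>" if "r \<in> {0<..<R}" for r using that by simp
  show "(\<integral>\<^sup>+r. a r * b r * w r \<partial>lborel) = roof_integral R c"
  proof (intro nn_integral_cong)
    fix r show "a r * b r * w r = ennreal (h (c * (1 - r / R)) * G r \<theta>) * indicator {0<..<R} r"
    proof (cases "r \<in> {0<..<R}")
      case True
      have "ennreal H * ennreal q * ennreal p = ennreal (H * (q * p))"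
        if "H \<ge> 0" "q \<ge> 0" for H q p :: real
        using that by (simp add: ennreal_mult' mult.assoc)
      from this[OF hn[of r] rn[OF True], of "r powr \<alpha>"] True show ?thesis
        unfolding a_def b_def w_def G[OF True] m[OF True] by simp
    qed (simp add: w_def)
  qed
  show "(\<integral>\<^sup>+r. w r \<partial>lborel) = weight_mass R"
    unfolding w_def by (rule nn_integral_powr_from_0[OF \<alpha> R])
  show "(\<integral>\<^sup>+r. a r * w r \<partial>lborel) = beta_term \<alpha> h c * weight_mass R"
    unfolding roof_weight_integral[OF R c, symmetric]
  proof (intro nn_integral_cong)
    fix r show "a r * w r = ennreal (h (c * (1 - r / R)) * r powr \<alpha>) * indicator {0<..<R} r"
      using hn[of r] m[of r] unfolding a_def w_def
      by (cases "r \<in> {0<..<R}") (simp_all add: ennreal_mult'[symmetric])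
  qed
  show "(\<integral>\<^sup>+r. b r * w r \<partial>lborel) = primitive G R \<theta>"
    unfolding primitive_def
  proof (intro nn_integral_cong)
    fix r show "b r * w r = ennreal (G r \<theta>) * indicator {0<..<R} r"
    proof (cases "r \<in> {0<..<R}")
      case True
      then show ?thesis
        using rn[OF True] G[OF True] unfolding b_def w_def
        by (simp add: ennreal_mult'[symmetric] del: times_divide_eq_left)
    qed (simp add: w_def)
  qed
qed

private lemma support: "w r \<noteq> 0 \<Longrightarrow> r \<in> {0<..<R}"
  unfolding w_def by (auto simp: indicator_def split: if_splits)

private lemma on_support:
  assumes "r \<in> {0<..<R}"
  shows "a r = ennreal (h (c * (1 - r / R)))" "b r = ennreal (ratio r)"
    "h (c * (1 - r / R)) \<ge> 0" "ratio r \<ge> 0"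
  using assms R c G_pos[of r] unfolding a_def b_def by (auto intro!: h_nonneg simp: max_def)

private lemma order_le:
  assumes G: "\<And>r u. r > 0 \<Longrightarrow> 0 < u \<Longrightarrow> u \<le> 1 \<Longrightarrow> G (u * r) \<theta> \<le> u powr \<alpha> * G r \<theta>"
    and "w x \<noteq> 0" "w y \<noteq> 0"
  shows "a x * b x + a y * b y \<le> a x * b y + a y * b x"
proof -
  have "(h (c * (1 - x / R)) - h (c * (1 - y / R))) * (ratio x - ratio y) \<le> 0"
  proof (cases "x \<le> y")
    case True
    then show ?thesis using support[OF assms(2)] support[OF assms(3)]
      roof_order[OF R c, of x y] ratio_mono[OF G, of x y] by (intro mult_nonneg_nonpos) auto
  next
    case False
    then show ?thesis using support[OF assms(2)] support[OF assms(3)]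
      roof_order[OF R c, of y x] ratio_mono[OF G, of y x] by (intro mult_nonpos_nonneg) auto
  qed
  then show ?thesis
    using on_support[OF support[OF assms(2)]] on_support[OF support[OF assms(3)]]
    by (simp add: ennreal_rearrangement del: times_divide_eq_left times_divide_eq_right)
qed

private lemma order_ge:
  assumes G: "\<And>r u. r > 0 \<Longrightarrow> 0 < u \<Longrightarrow> u \<le> 1 \<Longrightarrow> G (u * r) \<theta> \<ge> u powr \<alpha> * G r \<theta>"
    and "w x \<noteq> 0" "w y \<noteq> 0"
  shows "a x * b x + a y * b y \<ge> a x * b y + a y * b x"
proof -
  have "(h (c * (1 - x / R)) - h (c * (1 - y / R))) * (ratio x - ratio y) \<ge> 0"
  proof (cases "x \<le> y")
    case True
    then show ?thesis using support[OF assms(2)] support[OF assms(3)]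
      roof_order[OF R c, of x y] ratio_antimono[OF G, of x y] by (intro mult_nonneg_nonneg) auto
  next
    case False
    then show ?thesis using support[OF assms(2)] support[OF assms(3)]
      roof_order[OF R c, of y x] ratio_antimono[OF G, of y x] by (intro mult_nonpos_nonpos) auto
  qed
  then show ?thesis
    using on_support[OF support[OF assms(2)]] on_support[OF support[OF assms(3)]]
    by (simp add: ennreal_rearrangement(2) del: times_divide_eq_left times_divide_eq_right)
qed

text \<open>The roof decreases and the ratio increases, so the mean of the product is at most the product of
the means; the total weight cancels.\<close>

lemma roof_integral_le:
  assumes "\<And>r u. r > 0 \<Longrightarrow> 0 < u \<Longrightarrow> u \<le> 1 \<Longrightarrow> G (u * r) \<theta> \<le> u powr \<alpha> * G r \<theta>"
  shows "roof_integral R c \<le> beta_term \<alpha> h c * primitive G R \<theta>"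
proof -
  have "roof_integral R c * weight_mass R \<le> beta_term \<alpha> h c * weight_mass R * primitive G R \<theta>"
    using chebyshev_le[OF meas, OF order_le[OF assms]] unfolding integrals .
  then have "weight_mass R * roof_integral R c \<le> weight_mass R * (beta_term \<alpha> h c * primitive G R \<theta>)"
    by (simp add: mult_ac)
  then show ?thesis using weight_mass_cancel[OF R] by (subst (asm) ennreal_mult_le_mult_iff)
qed

text \<open>Here both factors decrease, which reverses the inequality.\<close>

lemma roof_integral_ge:
  assumes "\<And>r u. r > 0 \<Longrightarrow> 0 < u \<Longrightarrow> u \<le> 1 \<Longrightarrow> G (u * r) \<theta> \<ge> u powr \<alpha> * G r \<theta>"
  shows "roof_integral R c \<ge> beta_term \<alpha> h c * primitive G R \<theta>"
proof -
  have "roof_integral R c * weight_mass R \<ge> beta_term \<alpha> h c * weight_mass R * primitive G R \<theta>"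
    using chebyshev_ge[OF meas, OF order_ge[OF assms]] unfolding integrals .
  then have "weight_mass R * roof_integral R c \<ge> weight_mass R * (beta_term \<alpha> h c * primitive G R \<theta>)"
    by (simp add: mult_ac)
  then show ?thesis using weight_mass_cancel[OF R] by (subst (asm) ennreal_mult_le_mult_iff)
qed

text \<open>For a constant ratio the diagonal and the cross part coincide, so both directions of Chebyshev's
inequality apply.\<close>

lemma roof_integral_homogeneous:
  assumes hom: "homogeneous_upto G \<alpha> R \<theta>"
  shows "roof_integral R c = beta_term \<alpha> h c * primitive G R \<theta>"
proof -
  have "ratio x = ratio R" if "x \<in> {0<..<R}" for x
  proof -
    have "G (x / R * R) \<theta> = (x / R) powr \<alpha> * G R \<theta>"
      using hom that R unfolding homogeneous_upto_def by (auto simp del: times_divide_eq_left)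
    then show ?thesis using that R by (simp add: powr_divide field_simps)
  qed
  then have eq: "a x * b x + a y * b y = a x * b y + a y * b x" if "w x \<noteq> 0" "w y \<noteq> 0" for x y
    using on_support[OF support[OF that(1)]] on_support[OF support[OF that(2)]]
      support[OF that(1)] support[OF that(2)] by (simp add: algebra_simps)
  have "roof_integral R c * weight_mass R = beta_term \<alpha> h c * weight_mass R * primitive G R \<theta>"
    using chebyshev_le[OF meas, OF eq_refl, OF eq] chebyshev_ge[OF meas, OF eq_refl, OF eq[symmetric]]
    unfolding integrals by simp
  then have "weight_mass R * roof_integral R c = weight_mass R * (beta_term \<alpha> h c * primitive G R \<theta>)"
    by (simp add: mult_ac)
  then show ?thesis using weight_mass_cancel[OF R] by (simp add: ennreal_mult_cancel_left)
qed

text \<open>Equality forces \<open>(a x - a y) * (b x - b y) = 0\<close> for almost all \<open>x\<close> and \<open>y\<close>.  The first factor is non-zero for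
\<open>x \<noteq> y\<close>, because \<open>c > 0\<close> and \<open>h\<close> is injective.  Fixing one good \<open>x\<close>, the ratio equals its value at
\<open>x\<close> almost everywhere, hence by continuity everywhere on \<open>(0,R)\<close>.\<close>

lemma roof_integral_eq_imp_homogeneous:
  assumes G: "(\<forall>r u. r > 0 \<longrightarrow> 0 < u \<longrightarrow> u \<le> 1 \<longrightarrow> G (u * r) \<theta> \<le> u powr \<alpha> * G r \<theta>) \<or>
              (\<forall>r u. r > 0 \<longrightarrow> 0 < u \<longrightarrow> u \<le> 1 \<longrightarrow> G (u * r) \<theta> \<ge> u powr \<alpha> * G r \<theta>)"
    and h: "strict_mono_on {0..} h" and c_pos: "c > 0"
    and fin: "primitive G R \<theta> < \<infinity>"
    and eq: "roof_integral R c = beta_term \<alpha> h c * primitive G R \<theta>"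
  shows "homogeneous_upto G \<alpha> R \<theta>"
proof -
  have "AE x in lborel. w x \<noteq> 0 \<longrightarrow>
      (AE y in lborel. w y \<noteq> 0 \<longrightarrow> a x * b x + a y * b y = a x * b y + a y * b x)"
  proof (rule chebyshev_eq[OF meas])
    show "(\<forall>x y. w x \<noteq> 0 \<longrightarrow> w y \<noteq> 0 \<longrightarrow> a x * b x + a y * b y \<le> a x * b y + a y * b x) \<or>
          (\<forall>x y. w x \<noteq> 0 \<longrightarrow> w y \<noteq> 0 \<longrightarrow> a x * b x + a y * b y \<ge> a x * b y + a y * b x)"
      using G
    proof
      assume "\<forall>r u. r > 0 \<longrightarrow> 0 < u \<longrightarrow> u \<le> 1 \<longrightarrow> G (u * r) \<theta> \<le> u powr \<alpha> * G r \<theta>"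
      then show ?thesis using order_le by blast
    next
      assume "\<forall>r u. r > 0 \<longrightarrow> 0 < u \<longrightarrow> u \<le> 1 \<longrightarrow> G (u * r) \<theta> \<ge> u powr \<alpha> * G r \<theta>"
      then show ?thesis using order_ge by blast
    qed
    show "(\<integral>\<^sup>+r. a r * b r * w r \<partial>lborel) * (\<integral>\<^sup>+r. w r \<partial>lborel) =
        (\<integral>\<^sup>+r. a r * w r \<partial>lborel) * (\<integral>\<^sup>+r. b r * w r \<partial>lborel)"
      unfolding integrals eq by (simp add: mult_ac)
    show "(\<integral>\<^sup>+r. a r * w r \<partial>lborel) * (\<integral>\<^sup>+r. b r * w r \<partial>lborel) < \<infinity>"
      unfolding integrals using fin beta_term_finite[OF c] by (simp add: ennreal_mult_less_top)
    show "w x < \<infinity>" for x unfolding w_def by (simp add: indicator_def)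
  qed
  moreover have "w x \<noteq> 0" if "x \<in> {0<..<R}" for x
    using that unfolding w_def by simp
  moreover have "\<not> (AE x in lborel. x \<notin> {0<..<R})"
    using AE_lborel_open_imp[of "{0<..<R}"] R by (metis dense empty_iff greaterThanLessThan_iff open_greaterThanLessThan)
  ultimately obtain x where x: "x \<in> {0<..<R}"
    and AE: "AE y in lborel. w y \<noteq> 0 \<longrightarrow> a x * b x + a y * b y = a x * b y + a y * b x"
    by (smt (verit, best) eventually_mono)
  have "AE y in lborel. y \<in> {0<..<R} \<longrightarrow> ratio y = ratio x"
    using AE
  proof eventually_elim
    case (elim y)
    show ?case
    proof
      assume y: "y \<in> {0<..<R}"
      then have "w y \<noteq> 0" unfolding w_def by simp
      then have "(h (c * (1 - x / R)) - h (c * (1 - y / R))) * (ratio x - ratio y) = 0"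
        using elim on_support[OF x] on_support[OF y]
        by (simp add: ennreal_rearrangement del: times_divide_eq_left times_divide_eq_right mult_eq_0_iff)
      moreover have "h (c * (1 - x / R)) \<noteq> h (c * (1 - y / R))" if "x \<noteq> y"
      proof -
        have "inj_on h {0..}" using h by (simp add: strict_mono_on_imp_inj_on)
        moreover have "c * (1 - x / R) \<noteq> c * (1 - y / R)" using that c_pos R by auto
        moreover have "c * (1 - x / R) \<in> {0..}" "c * (1 - y / R) \<in> {0..}" using x y R c by auto
        ultimately show ?thesis by (auto dest: inj_onD)
      qed
      ultimately show "ratio y = ratio x" by auto
    qed
  qed
  then have const: "ratio y = ratio x" if "y \<in> {0<..<R}" for y
    by (rule AE_eq_continuous_on_open_imp_eq[where D = "{0<..<R}", rotated 3])
      (use that in \<open>auto intro!: continuous_intros continuous_on_subset[OF G_cont]\<close>)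
  \<comment> \<open>Homogeneity includes the end point \<open>R\<close>, which is reached by continuity of the density there.\<close>
  have "isCont ratio R"
    using R G_cont by (intro continuous_intros) (auto simp: continuous_on_eq_continuous_at)
  then have "(ratio \<longlongrightarrow> ratio R) (at_left R)"
    using filterlim_at_split isCont_def by blast
  moreover have "(ratio \<longlongrightarrow> ratio x) (at_left R)"
    by (rule tendsto_eventually, rule eventually_at_leftI[of 0]) (use const R in auto)
  ultimately have "ratio R = ratio x" using tendsto_unique trivial_limit_at_left_real by blast
  then have "ratio y = ratio x" if "0 < y" "y \<le> R" for y
    using const[of y] that by (cases "y = R") auto
  then have k: "G y \<theta> = ratio x * y powr \<alpha>" if "0 < y" "y \<le> R" for y
    using that by (metis divide_eq_eq powr_eq_0_iff less_irrefl)
  show ?thesis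
    unfolding homogeneous_upto_def
  proof (intro allI impI)
    fix r u :: real assume "0 < r" "r \<le> R" "0 < u" "u * r \<le> R"
    then show "G (u * r) \<theta> = u powr \<alpha> * G r \<theta>"
      using k[of r] k[of "u * r"] by (simp add: powr_mult)
  qed
qed

end

end

section \<open>Concave functions on a ray\<close>

lemma concave_on_line:
  fixes \<phi> :: "real \<Rightarrow> real"
  assumes "concave_on {0..<R} \<phi>" "0 \<le> r" "r \<le> s" "s < R" "0 < s"
  shows "(1 - r / s) * \<phi> 0 + (r / s) * \<phi> s \<le> \<phi> r"
proof -
  have "(1 - r / s) * \<phi> 0 + (r / s) * \<phi> s \<le> \<phi> ((1 - r / s) *\<^sub>R 0 + (r / s) *\<^sub>R s)"
    using assms by (intro concave_onD[OF assms(1)]) auto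
  also have "(1 - r / s) *\<^sub>R 0 + (r / s) *\<^sub>R s = r" using assms by simp
  finally show ?thesis .
qed

text \<open>The function lies above its chord over \<open>[0,s]\<close>, which lies above the chord that drops to \<open>0\<close> at \<open>s\<close>.
Only \<open>s < R\<close> is allowed, as concavity says nothing about the value at \<open>R\<close>; hence the limit \<open>s \<rightarrow> R\<close>.\<close>

lemma concave_nonneg_ge_roof:
  fixes \<phi> :: "real \<Rightarrow> real"
  assumes conc: "concave_on {0..<R} \<phi>" and nonneg: "\<And>r. 0 \<le> r \<Longrightarrow> r < R \<Longrightarrow> 0 \<le> \<phi> r"
    and r: "0 \<le> r" "r < R"
  shows "\<phi> 0 * (1 - r / R) \<le> \<phi> r"
proof -
  have "((\<lambda>s. (1 - r / s) * \<phi> 0) \<longlongrightarrow> (1 - r / R) * \<phi> 0) (at_left R)"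
    using r by (intro tendsto_intros) auto
  moreover have "eventually (\<lambda>s. (1 - r / s) * \<phi> 0 \<le> \<phi> r) (at_left R)"
  proof (rule eventually_at_leftI)
    show "r < R" by fact
    fix s assume s: "s \<in> {r<..<R}"
    then have "0 \<le> (r / s) * \<phi> s" using r nonneg[of s] by simp
    then show "(1 - r / s) * \<phi> 0 \<le> \<phi> r"
      using concave_on_line[OF conc, of r s] s r by simp
  qed
  ultimately have "(1 - r / R) * \<phi> 0 \<le> \<phi> r"
    by (rule tendsto_upperbound) simp
  then show ?thesis by (simp add: mult.commute)
qed

lemma concave_continuous_on_Ioo:
  fixes \<phi> :: "real \<Rightarrow> real"
  assumes "concave_on {0..<R} \<phi>"
  shows "continuous_on {0<..<R} \<phi>"
proof -
  have "convex_on {0<..<R} (\<lambda>r. - \<phi> r)"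
    using assms unfolding concave_on_def by (rule convex_on_subset) auto
  then have "continuous_on {0<..<R} (\<lambda>r. - (- \<phi> r))"
    by (intro continuous_on_minus convex_on_continuous) auto
  then show ?thesis by simp
qed

text \<open>The difference quotients at \<open>0\<close> decrease and, since the maximum is at \<open>0\<close>, are bounded above by \<open>0\<close>.
Their supremum is therefore finite, and it is the one-sided derivative; that every quotient is below it says that the function
lies below its tangent.\<close>

lemma concave_max_at_0_derivative:
  fixes \<phi> :: "real \<Rightarrow> real"
  assumes conc: "concave_on {0..<R} \<phi>" and R: "R > 0"
    and max: "\<And>r. 0 \<le> r \<Longrightarrow> r < R \<Longrightarrow> \<phi> r \<le> \<phi> 0"
  obtains d where "(\<phi> has_vector_derivative d) (at_right 0)" "d \<le> 0"
    "\<And>r. 0 \<le> r \<Longrightarrow> r < R \<Longrightarrow> \<phi> r \<le> \<phi> 0 + d * r"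
proof -
  define q where "q r = (\<phi> r - \<phi> 0) / r" for r
  have q_mono: "q s \<le> q r" if "0 < r" "r \<le> s" "s < R" for r s
    using concave_on_line[OF conc, of r s] that unfolding q_def by (simp add: field_simps)
  have q_nonpos: "q r \<le> 0" if "0 < r" "r < R" for r
    using max[of r] that unfolding q_def by (simp add: divide_le_0_iff)
  define d where "d = Sup (q ` {0<..<R})"
  have bdd: "bdd_above (q ` {0<..<R})" using q_nonpos by (intro bdd_aboveI2[of _ _ 0]) auto
  have q_le: "q r \<le> d" if "0 < r" "r < R" for r
    unfolding d_def using bdd that by (intro cSup_upper) auto
  have "d \<le> 0" unfolding d_def using R q_nonpos by (intro cSup_least) auto
  have "(q \<longlongrightarrow> d) (at_right 0)"
  proof (rule order_tendstoI)
    fix y assume "y < d"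
    then obtain r where r: "0 < r" "r < R" "y < q r"
      unfolding d_def using less_cSup_iff[OF _ bdd, of y] R by auto
    show "eventually (\<lambda>x. y < q x) (at_right 0)"
    proof (rule eventually_at_rightI)
      show "y < q x" if "x \<in> {0<..<r}" for x
        using q_mono[of x r] that r by simp
    qed (use r in simp)
  next
    fix y assume "d < y"
    then show "eventually (\<lambda>x. q x < y) (at_right 0)"
    proof (intro eventually_at_rightI)
      show "q x < y" if "x \<in> {0<..<R}" for x
        using q_le[of x] that \<open>d < y\<close> by simp
    qed (use R in simp)
  qed
  then have "(\<phi> has_field_derivative d) (at_right 0)"
    unfolding has_field_derivative_iff q_def by simp
  then have "(\<phi> has_vector_derivative d) (at_right 0)"
    by (simp add: has_real_derivative_iff_has_vector_derivative)
  moreover have "\<phi> r \<le> \<phi> 0 + d * r" if "0 \<le> r" "r < R" for r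
    using q_le[of r] that unfolding q_def by (cases "r = 0") (auto simp: field_simps)
  ultimately show thesis using that \<open>d \<le> 0\<close> by blast
qed


section \<open>Comparing a concave profile with a roof\<close>

context weighted_ray
begin

abbreviation ray_integral :: "real \<Rightarrow> (real \<Rightarrow> real) \<Rightarrow> ennreal" where
  "ray_integral R \<phi> \<equiv> (\<integral>\<^sup>+r\<in>{0<..<R}. ennreal (h (\<phi> r) * G r \<theta>) \<partial>lborel)"

lemma profile_mono:
  assumes "0 < r" "0 \<le> p" "p \<le> q"
  shows "0 \<le> h p * G r \<theta>" "h p * G r \<theta> \<le> h q * G r \<theta>"
  using assms G_pos[of r] h_nonneg[of p] by (auto intro!: mult_right_mono h_le)

lemma ray_integral_mono:
  assumes "\<And>r. 0 < r \<Longrightarrow> r < R \<Longrightarrow> 0 \<le> \<phi> r" "\<And>r. 0 < r \<Longrightarrow> r < R \<Longrightarrow> \<phi> r \<le> \<psi> r"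
  shows "ray_integral R \<phi> \<le> ray_integral R \<psi>"
proof (intro nn_integral_mono)
  fix r
  show "ennreal (h (\<phi> r) * G r \<theta>) * indicator {0<..<R} r \<le> ennreal (h (\<psi> r) * G r \<theta>) * indicator {0<..<R} r"
    using profile_mono(2)[of r "\<phi> r" "\<psi> r"] assms[of r]
    by (cases "r \<in> {0<..<R}") (auto intro!: ennreal_leI)
qed

lemma continuous_on_integrand:
  assumes "continuous_on {0<..<R} \<phi>" "\<And>r. 0 < r \<Longrightarrow> r < R \<Longrightarrow> 0 \<le> \<phi> r"
  shows "continuous_on {0<..<R} (\<lambda>r. h (\<phi> r) * G r \<theta>)"
  by (intro continuous_on_mult continuous_on_h_compose continuous_on_subset[OF G_cont])
    (use assms in auto)

text \<open>The integrands are ordered and continuous, so they agree pointwise; the density is positive and a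
strictly increasing \<open>h\<close> is injective.\<close>

lemma ray_integral_eq_imp_eq:
  assumes h: "strict_mono_on {0..} h"
    and cont: "continuous_on {0<..<R} \<phi>" "continuous_on {0<..<R} \<psi>"
    and le: "\<And>r. 0 < r \<Longrightarrow> r < R \<Longrightarrow> 0 \<le> \<phi> r" "\<And>r. 0 < r \<Longrightarrow> r < R \<Longrightarrow> \<phi> r \<le> \<psi> r"
    and eq: "ray_integral R \<phi> = ray_integral R \<psi>" and fin: "ray_integral R \<phi> < \<infinity>"
    and r: "0 < r" "r < R"
  shows "\<phi> r = \<psi> r"
proof -
  have le': "0 \<le> \<psi> r" if "0 < r" "r < R" for r using le[of r] that by linarith
  have "h (\<phi> r) * G r \<theta> = h (\<psi> r) * G r \<theta>"
  proof (rule nn_integral_eq_continuous_on_open_imp_eq[where D = "{0<..<R}", OF _ _ _ _ _ eq fin])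
    show "continuous_on {0<..<R} (\<lambda>r. h (\<phi> r) * G r \<theta>)" "continuous_on {0<..<R} (\<lambda>r. h (\<psi> r) * G r \<theta>)"
      by (intro continuous_on_integrand cont le le'; assumption)+
    show "0 \<le> h (\<phi> x) * G x \<theta>" "h (\<phi> x) * G x \<theta> \<le> h (\<psi> x) * G x \<theta>" if "x \<in> {0<..<R}" for x
      using profile_mono[of x "\<phi> x" "\<psi> x"] le[of x] that by auto
  qed (use r in auto)
  then have "h (\<phi> r) = h (\<psi> r)" using G_pos[OF r(1)] by simp
  moreover have "inj_on h {0..}" using h by (rule strict_mono_on_imp_inj_on)
  ultimately show ?thesis using le[OF r] le'[OF r] by (auto dest: inj_onD)
qed

lemma continuous_on_roof:
  fixes c R R' :: real
  shows "R > 0 \<Longrightarrow> continuous_on {0<..<R'} (\<lambda>r. c * (1 - r / R))"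
  by (intro continuous_intros) auto

lemma roof_nonneg: "0 \<le> c \<Longrightarrow> 0 < r \<Longrightarrow> r < R \<Longrightarrow> 0 \<le> c * (1 - r / R)" for c r R :: real
  by simp

lemma ray_integral_ge:
  assumes R: "R > 0" and conc: "concave_on {0..<R} \<phi>"
    and nonneg: "\<And>r. 0 \<le> r \<Longrightarrow> r < R \<Longrightarrow> 0 \<le> \<phi> r"
    and G: "\<And>r u. r > 0 \<Longrightarrow> 0 < u \<Longrightarrow> u \<le> 1 \<Longrightarrow> G (u * r) \<theta> \<ge> u powr \<alpha> * G r \<theta>"
  shows "beta_term \<alpha> h (\<phi> 0) * primitive G R \<theta> \<le> ray_integral R \<phi>"
proof -
  have "beta_term \<alpha> h (\<phi> 0) * primitive G R \<theta> \<le> roof_integral R (\<phi> 0)"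
    by (rule roof_integral_ge) (use R nonneg[of 0] G in auto)
  also have "\<dots> \<le> ray_integral R \<phi>"
  proof (intro ray_integral_mono roof_nonneg)
    show "\<phi> 0 * (1 - r / R) \<le> \<phi> r" if "0 < r" "r < R" for r
      using concave_nonneg_ge_roof[OF conc nonneg, of r] that by simp
  qed (use nonneg[of 0] R in simp_all)
  finally show ?thesis .
qed

text \<open>Equality splits into equality of the profile with the roof and equality for the roof itself.
A vanishing roof says nothing about the density, whence the condition \<open>\<phi> 0 > 0\<close> for homogeneity.\<close>

lemma ray_integral_ge_eq:
  assumes R: "R > 0" and conc: "concave_on {0..<R} \<phi>"
    and nonneg: "\<And>r. 0 \<le> r \<Longrightarrow> r < R \<Longrightarrow> 0 \<le> \<phi> r"
    and G: "\<And>r u. r > 0 \<Longrightarrow> 0 < u \<Longrightarrow> u \<le> 1 \<Longrightarrow> G (u * r) \<theta> \<ge> u powr \<alpha> * G r \<theta>"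
    and h: "strict_mono_on {0..} h"
    and fin: "primitive G R \<theta> < \<infinity>"
    and eq: "ray_integral R \<phi> = beta_term \<alpha> h (\<phi> 0) * primitive G R \<theta>"
  shows "\<And>r. 0 \<le> r \<Longrightarrow> r < R \<Longrightarrow> \<phi> r = \<phi> 0 * (1 - r / R)"
    and "\<phi> 0 > 0 \<Longrightarrow> homogeneous_upto G \<alpha> R \<theta>"
proof -
  have c: "\<phi> 0 \<ge> 0" using nonneg[of 0] R by simp
  have fin': "ray_integral R \<phi> < \<infinity>"
    unfolding eq using fin beta_term_finite[OF c] by (simp add: ennreal_mult_less_top)
  have le: "\<phi> 0 * (1 - r / R) \<le> \<phi> r" if "0 < r" "r < R" for r
    using concave_nonneg_ge_roof[OF conc nonneg, of r] that by simp
  have "roof_integral R (\<phi> 0) \<le> ray_integral R \<phi>"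
    by (intro ray_integral_mono roof_nonneg c le)
  moreover have "beta_term \<alpha> h (\<phi> 0) * primitive G R \<theta> \<le> roof_integral R (\<phi> 0)"
    by (rule roof_integral_ge[OF R c G])
  ultimately have eqs: "roof_integral R (\<phi> 0) = ray_integral R \<phi>"
      "roof_integral R (\<phi> 0) = beta_term \<alpha> h (\<phi> 0) * primitive G R \<theta>"
    unfolding eq by simp_all
  show "\<phi> r = \<phi> 0 * (1 - r / R)" if r: "0 \<le> r" "r < R" for r
  proof (cases "r = 0")
    case False
    then show ?thesis
      using ray_integral_eq_imp_eq[OF h continuous_on_roof[OF R] concave_continuous_on_Ioo[OF conc]
          roof_nonneg[OF c] le eqs(1), of r] r fin' eqs(1) by simp
  qed simp
  show "homogeneous_upto G \<alpha> R \<theta>" if "\<phi> 0 > 0"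
    by (rule roof_integral_eq_imp_homogeneous[OF R c disjI2 h that fin eqs(2)]) (intro allI impI G)
qed

lemma ray_integral_roof_homogeneous:
  assumes R: "R > 0" and nonneg: "0 \<le> \<phi> 0" and hom: "homogeneous_upto G \<alpha> R \<theta>"
    and roof: "\<And>r. 0 \<le> r \<Longrightarrow> r < R \<Longrightarrow> \<phi> r = \<phi> 0 * (1 - r / R)"
  shows "ray_integral R \<phi> = beta_term \<alpha> h (\<phi> 0) * primitive G R \<theta>"
proof -
  have "ray_integral R \<phi> = roof_integral R (\<phi> 0)"
  proof (intro nn_integral_cong)
    fix r
    show "ennreal (h (\<phi> r) * G r \<theta>) * indicator {0<..<R} r
        = ennreal (h (\<phi> 0 * (1 - r / R)) * G r \<theta>) * indicator {0<..<R} r"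
      using roof[of r] by (cases "r \<in> {0<..<R}") simp_all
  qed
  then show ?thesis using roof_integral_homogeneous[OF R nonneg hom] by simp
qed

text \<open>The profile lives on \<open>[0,R)\<close> but lies below a roof of the possibly larger length \<open>T\<close>, such as the tangent at \<open>0\<close>.  Three
steps lead from the profile to the final bound: raising it to the roof on \<open>(0,R)\<close>, extending the range to
\<open>(0,T)\<close>, and Chebyshev's inequality for the roof of length \<open>T\<close>.\<close>

context
  fixes R T :: real and \<phi> :: "real \<Rightarrow> real"
  assumes R: "R > 0" and RT: "R \<le> T" and c: "0 \<le> \<phi> 0"
    and conc: "concave_on {0..<R} \<phi>"
    and nonneg: "\<And>r. 0 \<le> r \<Longrightarrow> r < R \<Longrightarrow> 0 \<le> \<phi> r"
    and under: "\<And>r. 0 \<le> r \<Longrightarrow> r < R \<Longrightarrow> \<phi> r \<le> \<phi> 0 * (1 - r / T)"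
begin

lemma T_pos: "T > 0" using R RT by simp

lemma ray_integral_under_roof:
  "ray_integral R \<phi> \<le> ray_integral R (\<lambda>r. \<phi> 0 * (1 - r / T))"
  "ray_integral R (\<lambda>r. \<phi> 0 * (1 - r / T)) \<le> roof_integral T (\<phi> 0)"
proof -
  show "ray_integral R \<phi> \<le> ray_integral R (\<lambda>r. \<phi> 0 * (1 - r / T))"
    using nonneg under by (intro ray_integral_mono) auto
  show "ray_integral R (\<lambda>r. \<phi> 0 * (1 - r / T)) \<le> roof_integral T (\<phi> 0)"
    using RT by (intro nn_integral_mono) (auto simp: indicator_def)
qed

lemma ray_integral_le:
  assumes G: "\<And>r u. r > 0 \<Longrightarrow> 0 < u \<Longrightarrow> u \<le> 1 \<Longrightarrow> G (u * r) \<theta> \<le> u powr \<alpha> * G r \<theta>"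
  shows "ray_integral R \<phi> \<le> beta_term \<alpha> h (\<phi> 0) * primitive G T \<theta>"
  using ray_integral_under_roof roof_integral_le[OF T_pos c G] by simp

text \<open>All three steps must be equalities.  The second gives \<open>T = R\<close>, because the integrand is positive on
\<open>(R,T)\<close>; the first then identifies the profile with the roof, and the third gives homogeneity.\<close>

lemma ray_integral_le_eq:
  assumes G: "\<And>r u. r > 0 \<Longrightarrow> 0 < u \<Longrightarrow> u \<le> 1 \<Longrightarrow> G (u * r) \<theta> \<le> u powr \<alpha> * G r \<theta>"
    and h: "strict_mono_on {0..} h"
    and c_pos: "\<phi> 0 > 0" and fin: "primitive G T \<theta> < \<infinity>"
    and eq: "ray_integral R \<phi> = beta_term \<alpha> h (\<phi> 0) * primitive G T \<theta>"
  shows "T = R" "\<And>r. 0 \<le> r \<Longrightarrow> r < R \<Longrightarrow> \<phi> r = \<phi> 0 * (1 - r / R)" "homogeneous_upto G \<alpha> R \<theta>"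
proof -
  have fin': "ray_integral R \<phi> < \<infinity>"
    unfolding eq using fin beta_term_finite[OF c] by (simp add: ennreal_mult_less_top)
  have eqs: "ray_integral R \<phi> = ray_integral R (\<lambda>r. \<phi> 0 * (1 - r / T))"
    "ray_integral R (\<lambda>r. \<phi> 0 * (1 - r / T)) = roof_integral T (\<phi> 0)"
    "roof_integral T (\<phi> 0) = beta_term \<alpha> h (\<phi> 0) * primitive G T \<theta>"
    using ray_integral_under_roof roof_integral_le[OF T_pos c G] unfolding eq by simp_all
  let ?Q = "\<lambda>r. h (\<phi> 0 * (1 - r / T)) * G r \<theta>"
  have meas: "(\<lambda>r. ennreal (?Q r) * indicator {0<..<S} r) \<in> borel_measurable lborel" if "S \<le> T" for S
    using that T_pos c borel_measurable_ennreal_indicator[OF continuous_on_integrand[of S "\<lambda>r. \<phi> 0 * (1 - r / T)"]]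
    by (simp add: continuous_on_roof)
  have "AE r in lborel. ennreal (?Q r) * indicator {0<..<R} r = ennreal (?Q r) * indicator {0<..<T} r"
  proof (rule nn_integral_le_eq_imp_AE_eq[OF meas[OF RT] meas[OF order_refl] _ eqs(2)])
    show "ray_integral R (\<lambda>r. \<phi> 0 * (1 - r / T)) < \<infinity>" using eqs(1) fin' by simp
  qed (use RT in \<open>auto simp: indicator_def\<close>)
  then have "AE r in lborel. r \<notin> {R<..<T}"
  proof eventually_elim
    case (elim r)
    show ?case
    proof
      assume r: "r \<in> {R<..<T}"
      have "h 0 < h (\<phi> 0 * (1 - r / T))"
        using h r R c_pos by (intro strict_mono_onD[OF h]) auto
      then have "0 < ?Q r" using r R h_nonneg[of 0] G_pos[of r] by simp
      moreover have "r \<notin> {0<..<R}" "r \<in> {0<..<T}" using r R by auto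
      ultimately show False using elim by auto
    qed
  qed
  then have "{R<..<T} = {}" by (rule AE_lborel_open_imp) simp
  then show "T = R" using RT by simp
  show "\<phi> r = \<phi> 0 * (1 - r / R)" if r: "0 \<le> r" "r < R" for r
  proof (cases "r = 0")
    case False
    then show ?thesis
      using ray_integral_eq_imp_eq[OF h concave_continuous_on_Ioo[OF conc] continuous_on_roof[OF T_pos]
        nonneg[OF less_imp_le] under[OF less_imp_le] eqs(1) fin', of r] r \<open>T = R\<close> by simp
  qed simp
  have "homogeneous_upto G \<alpha> T \<theta>"
    by (rule roof_integral_eq_imp_homogeneous[OF T_pos c disjI1 h c_pos fin eqs(3)]) (intro allI impI G)
  then show "homogeneous_upto G \<alpha> R \<theta>" using \<open>T = R\<close> by simp
qed

end

end

section \<open>Spherical Lebesgue measure\<close>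

lemma measurable_sgn_sphere:
  "sgn \<in> measurable (restrict_space lborel (cball 0 1 - {0})) (restrict_space borel (sphere (0::'a::euclidean_space) 1))"
proof (rule measurable_restrict_space2)
  show "sgn \<in> space (restrict_space lborel (cball 0 1 - {0})) \<rightarrow> sphere (0::'a) 1"
    by (auto simp: norm_sgn space_restrict_space)
  have "(\<lambda>x::'a. inverse (norm x) *\<^sub>R x) \<in> borel_measurable borel" by measurable
  then have "(sgn :: 'a \<Rightarrow> 'a) \<in> borel_measurable lborel" by (simp add: sgn_div_norm[abs_def])
  then show "(sgn :: 'a \<Rightarrow> 'a) \<in> borel_measurable (restrict_space lborel (cball 0 1 - {0}))"
    by (rule measurable_restrict_space1)
qed

lemma space_sphere_measure [simp]: "space sphere_measure = sphere (0::'a::euclidean_space) 1"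
  by (simp add: sphere_measure_def space_scale_measure space_restrict_space)

lemma sets_sphere_measure [measurable_cong]:
  "sets (sphere_measure :: 'a::euclidean_space measure) = sets (restrict_space borel (sphere 0 1))"
  by (simp add: sphere_measure_def)

lemma emeasure_sphere_measure:
  fixes A :: "'a::euclidean_space set"
  assumes "A \<in> sets sphere_measure"
  shows "emeasure sphere_measure A =
    of_nat DIM('a) * emeasure lborel {x \<in> cball 0 1 - {0}. sgn x \<in> A}"
proof -
  have A: "A \<in> sets (restrict_space borel (sphere 0 1))"
    using assms by (simp add: sets_sphere_measure)
  have "emeasure (distr (restrict_space lborel (cball 0 1 - {0})) (restrict_space borel (sphere 0 1)) sgn) A
      = emeasure (restrict_space lborel (cball 0 1 - {0})) (sgn -` A \<inter> (cball 0 1 - {0}))"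
    using A by (subst emeasure_distr[OF measurable_sgn_sphere]) (auto simp: space_restrict_space)
  also have "\<dots> = emeasure lborel (sgn -` A \<inter> (cball 0 1 - {0}))"
    by (rule emeasure_restrict_space) auto
  also have "sgn -` A \<inter> (cball 0 1 - {0}) = {x \<in> cball 0 1 - {0}. sgn x \<in> A}" by auto
  finally show ?thesis by (simp add: sphere_measure_def)
qed

lemma finite_measure_sphere: "finite_measure (sphere_measure :: 'a::euclidean_space measure)"
proof
  have "emeasure (sphere_measure :: 'a measure) (sphere 0 1) =
      of_nat DIM('a) * emeasure lborel {x \<in> cball 0 1 - {0}. sgn x \<in> sphere (0::'a) 1}"
    using sets.top[of "sphere_measure :: 'a measure"] by (intro emeasure_sphere_measure) simp
  also have "\<dots> \<le> of_nat DIM('a) * emeasure lborel (cball (0::'a) 1)"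
    by (intro mult_left_mono emeasure_mono) auto
  also have "\<dots> < \<infinity>"
    using emeasure_lborel_cball_finite[of "0::'a" 1] by (simp add: ennreal_mult_less_top of_nat_less_top)
  finally show "emeasure (sphere_measure :: 'a measure) (space sphere_measure) \<noteq> \<infinity>" by simp
qed

text \<open>A non-empty relatively open set of directions is not a null set, since the cone over it contains a
non-empty open set of the ambient space.\<close>

lemma AE_sphere_open_ex:
  fixes U :: "'a::euclidean_space set"
  assumes P: "AE \<theta> in sphere_measure. P \<theta>" and U: "open U" and \<theta>: "\<theta> \<in> U" "\<theta> \<in> sphere 0 1"
  shows "\<exists>\<theta>\<in>U \<inter> sphere 0 1. P \<theta>"
proof (rule ccontr)
  assume "\<not> ?thesis"
  then have not_P: "\<not> P \<theta>" if "\<theta> \<in> U \<inter> sphere 0 1" for \<theta> using that by blast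
  have meas: "U \<inter> sphere 0 1 \<in> sets sphere_measure"
    using U by (auto simp: sets_sphere_measure sets_restrict_space)
  have "AE \<theta> in sphere_measure. \<theta> \<notin> U \<inter> sphere 0 1"
    using P by (rule eventually_mono) (use not_P in blast)
  then have "U \<inter> sphere 0 1 \<in> null_sets sphere_measure"
    using meas by (simp add: AE_iff_null_sets)
  then have "emeasure lborel {x \<in> cball 0 1 - {0}. sgn x \<in> U \<inter> sphere 0 1} = 0"
    using emeasure_sphere_measure[OF meas] by auto
  moreover define V where "V = (ball 0 1 - {0}) \<inter> sgn -` U"
  moreover have "V \<subseteq> {x \<in> cball 0 1 - {0}. sgn x \<in> U \<inter> sphere 0 1}"
    by (auto simp: V_def norm_sgn)
  moreover have "{x \<in> cball 0 1 - {0}. sgn x \<in> U \<inter> sphere 0 1} = (cball 0 1 - {0}) \<inter> sgn -` U"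
    by (auto simp: norm_sgn)
  moreover have "(cball 0 1 - {0}) \<inter> (sgn :: 'a \<Rightarrow> 'a) -` U \<in> sets borel"
  proof -
    have "(\<lambda>x::'a. inverse (norm x) *\<^sub>R x) \<in> borel_measurable borel" by measurable
    then have "(sgn :: 'a \<Rightarrow> 'a) \<in> borel_measurable borel" by (simp add: sgn_div_norm[abs_def])
    then have "sgn -` U \<in> sets borel" using measurable_sets[of sgn borel borel U] U by simp
    then show ?thesis by auto
  qed
  ultimately have "emeasure lborel V = 0"
    by (intro emeasure_eq_0[of "{x \<in> cball 0 1 - {0}. sgn x \<in> U \<inter> sphere 0 1}" lborel V]) simp_all
  have "open V" unfolding V_def using U
    by (intro continuous_open_preimage continuous_on_sgn continuous_intros) auto
  then have "AE x in lborel. x \<notin> V"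
    using \<open>emeasure lborel V = 0\<close> by (intro AE_not_in) (auto intro: null_setsI)
  then have "V = {}" using \<open>open V\<close> by (rule AE_lborel_open_imp)
  \<comment> \<open>Half of a unit vector lies inside the open unit ball, where the cone is open.\<close>
  moreover have "sgn \<theta> = \<theta>" using \<theta> by (simp add: sgn_div_norm)
  then have "(1/2) *\<^sub>R \<theta> \<in> V" using \<theta> by (auto simp: V_def sgn_scaleR)
  ultimately show False by simp
qed

text \<open>Sets of full measure are dense in the sphere; with continuity, this turns statements about almost
every direction into statements about every direction.\<close>

lemma AE_sphere_sequence:
  fixes \<theta> :: "'a::euclidean_space"
  assumes P: "AE \<theta> in sphere_measure. P \<theta>" and \<theta>: "\<theta> \<in> sphere 0 1"
  obtains X where "\<And>n. X n \<in> sphere 0 1" "\<And>n. P (X n)" "X \<longlonglongrightarrow> \<theta>"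
proof -
  have "\<exists>x. x \<in> ball \<theta> (1 / real (Suc n)) \<and> x \<in> sphere 0 1 \<and> P x" for n
    using AE_sphere_open_ex[OF P, of "ball \<theta> (1 / real (Suc n))" \<theta>] \<theta> by auto
  then have "\<exists>X. \<forall>n. X n \<in> ball \<theta> (1 / real (Suc n)) \<and> X n \<in> sphere 0 1 \<and> P (X n)"
    by (intro choice allI)
  then obtain X where X: "\<And>n. X n \<in> ball \<theta> (1 / real (Suc n)) \<and> X n \<in> sphere 0 1 \<and> P (X n)"
    by blast
  have "(\<lambda>n. dist (X n) \<theta>) \<longlonglongrightarrow> 0"
  proof (rule tendsto_sandwich[OF _ _ tendsto_const lim_1_over_n[THEN LIMSEQ_Suc]])
    show "\<forall>\<^sub>F n in sequentially. dist (X n) \<theta> \<le> 1 / of_nat (Suc n)"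
      using X by (intro always_eventually allI) (simp add: dist_commute less_imp_le)
  qed simp
  then have "X \<longlonglongrightarrow> \<theta>" by (rule tendsto_dist_iff[THEN iffD2])
  with X that show thesis by blast
qed

section \<open>Radial functions\<close>

context
  fixes L :: "'a::euclidean_space set"
  assumes compact: "compact L" and convex: "convex L" and interior: "0 \<in> interior L"
begin

text \<open>By convexity and compactness, a ray from the interior point \<open>0\<close> meets \<open>L\<close> in a closed segment, whose
length is attained by the supremum that defines \<open>radial L\<close>.\<close>

lemma radial_ray:
  assumes \<theta>: "\<theta> \<in> sphere 0 1"
  shows "radial L \<theta> > 0" and "\<And>\<tau>. 0 \<le> \<tau> \<Longrightarrow> \<tau> *\<^sub>R \<theta> \<in> L \<longleftrightarrow> \<tau> \<le> radial L \<theta>"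
proof -
  define T where "T = {\<tau>. \<tau> *\<^sub>R \<theta> \<in> L}"
  have r: "radial L \<theta> = Sup T" unfolding radial_def T_def ..
  obtain B where B: "\<And>x. x \<in> L \<Longrightarrow> norm x \<le> B"
    using compact by (meson bounded_iff compact_imp_bounded)
  have bdd: "bdd_above T"
  proof (rule bdd_aboveI)
    show "\<tau> \<le> B" if "\<tau> \<in> T" for \<tau>
      using B[of "\<tau> *\<^sub>R \<theta>"] that \<theta> by (simp add: T_def)
  qed
  obtain e where e: "e > 0" "cball 0 e \<subseteq> L"
    using interior by (metis mem_interior_cball)
  then have "e \<in> T" using \<theta> by (auto simp: T_def)
  then show pos: "radial L \<theta> > 0" unfolding r using e cSup_upper[OF _ bdd, of e] by simp
  have "closed T"
  proof -
    have "T = (\<lambda>\<tau>. \<tau> *\<^sub>R \<theta>) -` L" by (auto simp: T_def)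
    then show ?thesis
      using compact_imp_closed[OF compact]
      by (simp only:) (intro continuous_closed_vimage continuous_intros)
  qed
  then have "Sup T \<in> T" using bdd \<open>e \<in> T\<close> by (intro closed_contains_Sup) auto
  then have mem: "radial L \<theta> *\<^sub>R \<theta> \<in> L" unfolding r T_def by simp
  have "0 \<in> L" using interior interior_subset by auto
  show "\<tau> *\<^sub>R \<theta> \<in> L \<longleftrightarrow> \<tau> \<le> radial L \<theta>" if "0 \<le> \<tau>" for \<tau>
  proof
    assume "\<tau> *\<^sub>R \<theta> \<in> L"
    then show "\<tau> \<le> radial L \<theta>" unfolding r using bdd by (intro cSup_upper) (auto simp: T_def)
  next
    assume "\<tau> \<le> radial L \<theta>"
    then have "(\<tau> / radial L \<theta>) *\<^sub>R (radial L \<theta> *\<^sub>R \<theta>) + (1 - \<tau> / radial L \<theta>) *\<^sub>R 0 \<in> L"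
      using that pos by (intro convexD[OF convex mem \<open>0 \<in> L\<close>]) auto
    then show "\<tau> *\<^sub>R \<theta> \<in> L" using pos by simp
  qed
qed

lemma radial_bounded: "\<exists>B. \<forall>\<theta>\<in>sphere 0 1. radial L \<theta> \<le> B"
proof -
  obtain B where B: "\<And>x. x \<in> L \<Longrightarrow> norm x \<le> B"
    using compact by (meson bounded_iff compact_imp_bounded)
  have "radial L \<theta> \<le> B" if "\<theta> \<in> sphere 0 1" for \<theta>
    using radial_ray[OF that] B[of "radial L \<theta> *\<^sub>R \<theta>"] that by auto
  then show ?thesis by blast
qed

lemma radial_interior:
  assumes \<theta>: "\<theta> \<in> sphere 0 1" and t: "0 < t" "t < radial L \<theta>"
  shows "t *\<^sub>R \<theta> \<in> interior L"
proof -
  have "radial L \<theta> *\<^sub>R \<theta> \<in> closure L"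
    using radial_ray(1)[OF \<theta>] radial_ray(2)[OF \<theta>, of "radial L \<theta>"]
    by (intro subsetD[OF closure_subset]) simp
  then have sub: "open_segment 0 (radial L \<theta> *\<^sub>R \<theta>) \<subseteq> interior L"
    by (intro in_interior_closure_convex_segment convex interior)
  have "t *\<^sub>R \<theta> \<in> open_segment 0 (radial L \<theta> *\<^sub>R \<theta>)"
    unfolding in_segment using t \<theta> by (auto intro!: exI[of _ "t / radial L \<theta>"])
  with sub show ?thesis by blast
qed

text \<open>Below the radial function, points on the ray are interior to \<open>L\<close>; beyond it, they lie in the open
complement.  Both properties persist for nearby directions, which gives the two halves of continuity.\<close>

lemma continuous_on_radial: "continuous_on (sphere 0 1) (radial L)"
  unfolding continuous_on
proof
  fix \<theta> :: 'a assume \<theta>: "\<theta> \<in> sphere 0 1"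
  have ev: "eventually (\<lambda>x. x \<in> sphere 0 1 \<and> t *\<^sub>R x \<in> U) (at \<theta> within sphere 0 1)"
    if "open U" "t *\<^sub>R \<theta> \<in> U" for t U
  proof -
    have "((\<lambda>x. t *\<^sub>R x) \<longlongrightarrow> t *\<^sub>R \<theta>) (at \<theta> within sphere 0 1)" by (intro tendsto_intros)
    from topological_tendstoD[OF this that]
    show ?thesis by (auto simp: eventually_at_filter elim: eventually_mono)
  qed
  show "(radial L \<longlongrightarrow> radial L \<theta>) (at \<theta> within sphere 0 1)"
  proof (rule order_tendstoI)
    fix a assume "a < radial L \<theta>"
    then have "max a 0 < radial L \<theta>" using radial_ray(1)[OF \<theta>] by simp
    then obtain t where "max a 0 < t" "t < radial L \<theta>" by (rule dense[THEN exE]) auto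
    then have t: "0 < t" "a < t" "t < radial L \<theta>" by auto
    show "\<forall>\<^sub>F x in at \<theta> within sphere 0 1. a < radial L x"
      using ev[OF open_interior radial_interior[OF \<theta> t(1,3)]]
    proof eventually_elim
      case (elim x)
      then have "t *\<^sub>R x \<in> L" using interior_subset by blast
      then show ?case using radial_ray(2)[of x t] elim t by auto
    qed
  next
    fix a assume a: "radial L \<theta> < a"
    then have "0 \<le> a" using radial_ray(1)[OF \<theta>] by simp
    then have "a *\<^sub>R \<theta> \<in> - L" using radial_ray(2)[OF \<theta>, of a] a by simp
    moreover have "open (- L)" using compact compact_imp_closed by blast
    ultimately have "\<forall>\<^sub>F x in at \<theta> within sphere 0 1. x \<in> sphere 0 1 \<and> a *\<^sub>R x \<in> - L"
      by (intro ev)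
    then show "\<forall>\<^sub>F x in at \<theta> within sphere 0 1. radial L x < a"
    proof eventually_elim
      case (elim x)
      then show ?case using radial_ray(2)[of x a] \<open>0 \<le> a\<close> by auto
    qed
  qed
qed

end

definition radial_body :: "('a::euclidean_space \<Rightarrow> real) \<Rightarrow> 'a set" where
  "radial_body \<rho> = {x. x = 0 \<or> norm x \<le> \<rho> (sgn x)}"

lemma convex_eq_radial_body:
  assumes "compact L" "convex L" "0 \<in> interior L"
  shows "L = radial_body (radial L)"
proof -
  have "0 \<in> L" using assms interior_subset by auto
  moreover have "x \<in> L \<longleftrightarrow> norm x \<le> radial L (sgn x)" if "x \<noteq> 0" for x
  proof -
    have "norm x *\<^sub>R sgn x = x" using that by (simp add: sgn_div_norm)
    then show ?thesis using radial_ray(2)[OF assms, of "sgn x" "norm x"] that by (simp add: norm_sgn)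
  qed
  ultimately have "x \<in> L \<longleftrightarrow> x \<in> radial_body (radial L)" for x
    unfolding radial_body_def by (cases "x = 0") simp_all
  then show ?thesis by blast
qed

lemma radial_body_mono:
  assumes "\<And>\<theta>. \<theta> \<in> sphere 0 1 \<Longrightarrow> \<rho> \<theta> \<le> \<sigma> \<theta>"
  shows "radial_body \<rho> \<subseteq> radial_body \<sigma>"
proof
  fix x assume "x \<in> radial_body \<rho>"
  then show "x \<in> radial_body \<sigma>"
    unfolding radial_body_def using assms[of "sgn x"] by (cases "x = 0") (auto simp: norm_sgn)
qed

lemma star_shaped_radial_body: "star_shaped_at_0 (radial_body \<rho>)"
  unfolding star_shaped_at_0_def
proof (intro conjI ballI subsetI)
  show "0 \<in> radial_body \<rho>" by (simp add: radial_body_def)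
  fix x y assume x: "x \<in> radial_body \<rho>" and "y \<in> closed_segment 0 x"
  then obtain u where u: "0 \<le> u" "u \<le> 1" "y = u *\<^sub>R x" by (auto simp: in_segment)
  show "y \<in> radial_body \<rho>"
  proof (cases "y = 0")
    case False
    then have "u > 0" "x \<noteq> 0" using u by auto
    then have "sgn y = sgn x" "norm y \<le> norm x" using u by (auto simp: sgn_scaleR mult_left_le_one_le)
    then show ?thesis using x \<open>x \<noteq> 0\<close> by (auto simp: radial_body_def)
  qed (simp add: radial_body_def)
qed

text \<open>The supremum in \<open>radial\<close> also ranges over negative multiples, that is, over the opposite ray; these are
harmless because \<open>\<rho> \<theta>\<close> is positive.\<close>

lemma radial_radial_body:
  assumes pos: "\<And>\<theta>. \<theta> \<in> sphere 0 1 \<Longrightarrow> \<rho> \<theta> > 0" and \<theta>: "\<theta> \<in> sphere 0 1"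
  shows "radial (radial_body \<rho>) \<theta> = \<rho> \<theta>"
  unfolding radial_def
proof (rule cSup_eq_maximum)
  have s: "sgn \<theta> = \<theta>" using \<theta> by (simp add: sgn_div_norm)
  show "\<rho> \<theta> \<in> {\<tau>. \<tau> *\<^sub>R \<theta> \<in> radial_body \<rho>}"
    using pos[OF \<theta>] \<theta> s by (simp add: radial_body_def sgn_scaleR)
  fix \<tau> assume "\<tau> \<in> {\<tau>. \<tau> *\<^sub>R \<theta> \<in> radial_body \<rho>}"
  then show "\<tau> \<le> \<rho> \<theta>"
    using pos[OF \<theta>] \<theta> s by (cases "\<tau> > 0") (auto simp: radial_body_def sgn_scaleR)
qed

text \<open>The body is the image of the compact set \<open>[0,1] \<times> S\<close>, with \<open>S\<close> the unit sphere, under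
\<open>(t, \<theta>) \<mapsto> t \<rho>(\<theta>) \<theta>\<close>.\<close>

lemma compact_radial_body:
  assumes pos: "\<And>\<theta>. \<theta> \<in> sphere 0 1 \<Longrightarrow> \<rho> \<theta> > 0" and cont: "continuous_on (sphere 0 1) \<rho>"
  shows "compact (radial_body \<rho> :: 'a::euclidean_space set)"
proof -
  let ?F = "\<lambda>(t, \<theta>). (t * \<rho> \<theta>) *\<^sub>R \<theta> :: 'a"
  have "radial_body \<rho> = ?F ` ({0..1} \<times> sphere 0 1)"
  proof (intro equalityI subsetI)
    fix x :: 'a assume x: "x \<in> radial_body \<rho>"
    show "x \<in> ?F ` ({0..1} \<times> sphere 0 1)"
    proof (cases "x = 0")
      case True
      obtain b :: 'a where "b \<in> Basis" using nonempty_Basis by blast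
      then show ?thesis using True by (intro image_eqI[of _ _ "(0, b)"]) auto
    next
      case False
      then have \<theta>: "sgn x \<in> sphere 0 1" by (simp add: norm_sgn)
      have "norm x \<le> \<rho> (sgn x)" using x False by (simp add: radial_body_def)
      then show ?thesis using False pos[OF \<theta>] \<theta>
        by (intro image_eqI[of _ _ "(norm x / \<rho> (sgn x), sgn x)"]) (auto simp: sgn_div_norm)
    qed
  next
    fix x :: 'a assume "x \<in> ?F ` ({0..1} \<times> sphere 0 1)"
    then obtain t \<theta> where x: "x = (t * \<rho> \<theta>) *\<^sub>R \<theta>" "0 \<le> t" "t \<le> 1" "\<theta> \<in> sphere 0 1" by auto
    have s: "sgn \<theta> = \<theta>" using x(4) by (simp add: sgn_div_norm)
    show "x \<in> radial_body \<rho>"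
    proof (cases "t = 0")
      case False
      then have "sgn x = \<theta>" "norm x \<le> \<rho> \<theta>"
        using x pos[OF x(4)] s by (simp_all add: sgn_scaleR mult_left_le_one_le)
      then show ?thesis by (simp add: radial_body_def)
    qed (simp add: x radial_body_def)
  qed
  moreover have "compact (?F ` ({0..1} \<times> sphere 0 1))"
  proof (rule compact_continuous_image)
    show "continuous_on ({0..1} \<times> sphere 0 1) ?F"
      unfolding case_prod_beta
      by (intro continuous_intros continuous_on_compose2[OF cont]) auto
  qed (intro compact_Times compact_sphere compact_Icc)
  ultimately show ?thesis by simp
qed

section \<open>Measurability of radial integrals\<close>

text \<open>The integrands are measurable on \<open>(0,\<infinity>)\<close> only.  This retraction of the line onto \<open>(0,\<infinity>)\<close> extends them to
measurable functions of all radii without changing them where they are integrated.\<close>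

definition pos_or_1 :: "real \<Rightarrow> real" where "pos_or_1 r = (if r > 0 then r else 1)"

lemma measurable_pos_or_1: "pos_or_1 \<in> measurable borel (restrict_space borel {0<..})"
  unfolding pos_or_1_def by (rule measurable_restrict_space2) auto

lemma borel_measurable_pos_or_1_compose:
  assumes "(\<lambda>(r, \<theta>). F r \<theta>) \<in> borel_measurable (restrict_space borel {0<..} \<Otimes>\<^sub>M N)"
  shows "(\<lambda>(r, \<theta>). F (pos_or_1 r) \<theta> :: real) \<in> borel_measurable (borel \<Otimes>\<^sub>M N)"
proof -
  have "(\<lambda>(r, \<theta>). (pos_or_1 r, \<theta>)) \<in> measurable (borel \<Otimes>\<^sub>M N) (restrict_space borel {0<..} \<Otimes>\<^sub>M N)"
    unfolding case_prod_beta
    by (intro measurable_Pair measurable_compose[OF measurable_fst measurable_pos_or_1] measurable_snd)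
  from measurable_compose[OF this assms] show ?thesis by (simp add: case_prod_beta)
qed

lemma borel_measurable_primitive:
  assumes F: "(\<lambda>(r, \<theta>). F r \<theta>) \<in> borel_measurable (restrict_space borel {0<..} \<Otimes>\<^sub>M N)"
    and [measurable]: "\<rho> \<in> borel_measurable N"
  shows "(\<lambda>\<theta>. primitive F (\<rho> \<theta>) \<theta>) \<in> borel_measurable N"
proof -
  have [measurable]: "(\<lambda>(r, \<theta>). F (pos_or_1 r) \<theta>) \<in> borel_measurable (borel \<Otimes>\<^sub>M N)"
    by (rule borel_measurable_pos_or_1_compose[OF F])
  have "(\<lambda>\<theta>. \<integral>\<^sup>+r. ennreal (F (pos_or_1 r) \<theta>) * (if 0 < r \<and> r < \<rho> \<theta> then 1 else 0) \<partial>lborel) \<in> borel_measurable N"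
    by measurable
  also have "(\<lambda>\<theta>. \<integral>\<^sup>+r. ennreal (F (pos_or_1 r) \<theta>) * (if 0 < r \<and> r < \<rho> \<theta> then 1 else 0) \<partial>lborel)
      = (\<lambda>\<theta>. primitive F (\<rho> \<theta>) \<theta>)"
    unfolding primitive_def by (intro ext nn_integral_cong) (auto simp: pos_or_1_def indicator_def)
  finally show ?thesis .
qed

section \<open>A concave profile on every ray of a convex body\<close>

locale dual_volume_setting = monotone_profile h \<alpha>
  for h :: "real \<Rightarrow> real" and \<alpha> :: real +
  fixes L :: "'a::euclidean_space set" and f G :: "real \<Rightarrow> 'a \<Rightarrow> real"
  assumes compact_L: "compact L" and convex_L: "convex L" and interior_L: "0 \<in> interior L"
    and f_nonneg: "\<And>r \<theta>. r \<ge> 0 \<Longrightarrow> \<theta> \<in> sphere 0 1 \<Longrightarrow> f r \<theta> \<ge> 0"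
    and f_concave: "\<And>\<theta>. \<theta> \<in> sphere 0 1 \<Longrightarrow> concave_on {0..<radial L \<theta>} (\<lambda>t. f t \<theta>)"
    and f_meas: "(\<lambda>(r, \<theta>). f r \<theta>) \<in> borel_measurable (restrict_space borel {0..} \<Otimes>\<^sub>M sphere_measure)"
    and G_pos: "\<And>r \<theta>. r > 0 \<Longrightarrow> \<theta> \<in> sphere 0 1 \<Longrightarrow> G r \<theta> > 0"
    and G_cont: "continuous_on ({0<..} \<times> sphere 0 1) (\<lambda>(r, \<theta>). G r \<theta>)"
    and G_int: "\<And>R. R > 0 \<Longrightarrow>
      (\<integral>\<^sup>+(r, \<theta>)\<in>{0<..<R} \<times> sphere 0 1. ennreal (G r \<theta>) \<partial>(lborel \<Otimes>\<^sub>M sphere_measure)) < \<infinity>"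
begin

lemma weighted_ray: "\<theta> \<in> sphere 0 1 \<Longrightarrow> weighted_ray h \<alpha> G \<theta>"
proof unfold_locales
  assume \<theta>: "\<theta> \<in> sphere 0 1"
  show "G r \<theta> > 0" if "r > 0" for r using G_pos[OF that \<theta>] .
  have "continuous_on {0<..} (\<lambda>r. (\<lambda>(r, \<theta>). G r \<theta>) (r, \<theta>))"
    by (rule continuous_on_compose2[OF G_cont]) (use \<theta> in \<open>auto intro!: continuous_intros\<close>)
  then show "continuous_on {0<..} (\<lambda>r. G r \<theta>)" by simp
qed

lemmas L_body = compact_L convex_L interior_L
lemmas radial_pos = radial_ray(1)[OF L_body]

lemma radial_meas [measurable]: "radial L \<in> borel_measurable sphere_measure"
  using borel_measurable_continuous_on_restrict[OF continuous_on_radial[OF L_body]]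
  by (simp cong: measurable_cong_sets add: sets_sphere_measure)

lemma f_slice_meas [measurable]: "r \<ge> 0 \<Longrightarrow> (\<lambda>\<theta>. f r \<theta>) \<in> borel_measurable sphere_measure"
proof -
  assume r: "r \<ge> 0"
  have "(\<lambda>\<theta>. (r, \<theta>)) \<in> measurable sphere_measure (restrict_space borel {0..} \<Otimes>\<^sub>M sphere_measure)"
    using r by (intro measurable_Pair1') (simp add: space_restrict_space)
  from measurable_compose[OF this f_meas] show ?thesis by simp
qed

lemma G_meas: "(\<lambda>(r, \<theta>). G r \<theta>) \<in> borel_measurable (restrict_space borel {0<..} \<Otimes>\<^sub>M sphere_measure)"
proof -
  let ?N = "restrict_space borel {0::real<..} \<Otimes>\<^sub>M (sphere_measure :: 'a measure)"
  have id: "(\<lambda>r::real. r) \<in> measurable (restrict_space borel {0<..}) borel"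
    "(\<lambda>\<theta>::'a. \<theta>) \<in> measurable sphere_measure borel"
    by (auto intro: measurable_restrict_space1 simp: measurable_cong_sets[OF sets_sphere_measure refl])
  have "(\<lambda>x. (fst x, snd x)) \<in> measurable ?N (borel \<Otimes>\<^sub>M borel)"
    using measurable_compose[OF measurable_fst id(1), of sphere_measure]
      measurable_compose[OF measurable_snd id(2), of "restrict_space borel {0<..}"]
    by (intro measurable_Pair) simp_all
  then have "(\<lambda>x. x) \<in> measurable ?N (borel :: (real \<times> 'a) measure)" by (simp add: borel_prod)
  then have "(\<lambda>x. x) \<in> measurable ?N (restrict_space borel ({0<..} \<times> sphere 0 1))"
    by (intro measurable_restrict_space2) (auto simp: space_pair_measure space_restrict_space)
  from measurable_compose[OF this borel_measurable_continuous_on_restrict[OF G_cont]]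
  show ?thesis by simp
qed

lemma borel_measurable_restrict_pos:
  fixes F :: "real \<Rightarrow> 'a \<Rightarrow> real"
  assumes "(\<lambda>(r, \<theta>). F r \<theta>) \<in> borel_measurable (restrict_space borel {0..} \<Otimes>\<^sub>M sphere_measure)"
  shows "(\<lambda>(r, \<theta>). F r \<theta> :: real) \<in> borel_measurable (restrict_space borel {0<..} \<Otimes>\<^sub>M (sphere_measure :: 'a measure))"
proof -
  have id: "(\<lambda>r::real. r) \<in> measurable (restrict_space borel {0<..}) (restrict_space borel {0..})"
    by (intro measurable_restrict_space2 measurable_restrict_space1) (auto simp: space_restrict_space)
  have "(\<lambda>x. (fst x, snd x)) \<in> measurable (restrict_space borel {0::real<..} \<Otimes>\<^sub>M (sphere_measure :: 'a measure))
      (restrict_space borel {0..} \<Otimes>\<^sub>M sphere_measure)"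
    using measurable_compose[OF measurable_fst id, of "sphere_measure :: 'a measure"]
    by (intro measurable_Pair) simp_all
  from measurable_compose[OF this assms] show ?thesis by (simp add: case_prod_beta)
qed

lemma integrand_meas:
  assumes p: "(\<lambda>(r, \<theta>). p r \<theta>) \<in> borel_measurable (restrict_space borel {0..} \<Otimes>\<^sub>M sphere_measure)"
    and p_nonneg: "\<And>r \<theta>. r \<ge> 0 \<Longrightarrow> \<theta> \<in> sphere 0 1 \<Longrightarrow> p r \<theta> \<ge> 0"
  shows "(\<lambda>(r, \<theta>). h (p r \<theta>) * G r \<theta>) \<in> borel_measurable (restrict_space borel {0<..} \<Otimes>\<^sub>M sphere_measure)"
    (is "_ \<in> borel_measurable ?N")
proof -
  have "continuous_on UNIV (\<lambda>x. h (max 0 x))"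
    by (intro continuous_on_h_compose continuous_intros) auto
  then have [measurable]: "(\<lambda>x. h (max 0 x)) \<in> borel_measurable borel"
    by (rule borel_measurable_continuous_onI)
  have [measurable]: "(\<lambda>x. p (fst x) (snd x)) \<in> borel_measurable ?N"
    "(\<lambda>x. G (fst x) (snd x)) \<in> borel_measurable ?N"
    using borel_measurable_restrict_pos[OF p] G_meas by (simp_all add: case_prod_beta)
  have "(\<lambda>x. h (max 0 (p (fst x) (snd x))) * G (fst x) (snd x)) \<in> borel_measurable ?N" by measurable
  then show ?thesis
    by (rule measurable_cong[THEN iffD1, rotated])
      (use p_nonneg in \<open>auto simp: space_pair_measure space_restrict_space max_def\<close>)
qed

text \<open>Tonelli's theorem passes from the integral over \<open>(0,R) \<times> S\<close>, with \<open>S\<close> the unit sphere, to the iterated one.\<close>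

lemma integral_primitive_finite:
  assumes R: "R > 0"
  shows "(\<integral>\<^sup>+\<theta>. primitive G R \<theta> \<partial>sphere_measure) < \<infinity>"
proof -
  interpret S: finite_measure "sphere_measure :: 'a measure" by (rule finite_measure_sphere)
  interpret P: pair_sigma_finite lborel "sphere_measure :: 'a measure" ..
  have [measurable]: "(\<lambda>(r, \<theta>). G (pos_or_1 r) \<theta>) \<in> borel_measurable (borel \<Otimes>\<^sub>M sphere_measure)"
    by (rule borel_measurable_pos_or_1_compose[OF G_meas])
  let ?g = "\<lambda>(r, \<theta>). ennreal (G (pos_or_1 r) \<theta>) * (if 0 < r \<and> r < R then 1 else 0)"
  have "(\<integral>\<^sup>+\<theta>. primitive G R \<theta> \<partial>sphere_measure) = (\<integral>\<^sup>+\<theta>. \<integral>\<^sup>+r. ?g (r, \<theta>) \<partial>lborel \<partial>sphere_measure)"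
    unfolding primitive_def by (intro nn_integral_cong) (auto simp: pos_or_1_def indicator_def)
  also have "\<dots> = (\<integral>\<^sup>+x. ?g x \<partial>(lborel \<Otimes>\<^sub>M sphere_measure))"
    by (rule P.nn_integral_snd) measurable
  also have "\<dots> = (\<integral>\<^sup>+(r, \<theta>)\<in>{0<..<R} \<times> sphere 0 1. ennreal (G r \<theta>) \<partial>(lborel \<Otimes>\<^sub>M sphere_measure))"
    by (intro nn_integral_cong) (auto simp: pos_or_1_def indicator_def space_pair_measure split: if_splits)
  also have "\<dots> < \<infinity>" by (rule G_int[OF R])
  finally show ?thesis .
qed

lemma integral_primitive_bounded_finite:
  assumes "\<And>\<theta>. \<theta> \<in> sphere 0 1 \<Longrightarrow> \<rho> \<theta> \<le> B"
  shows "(\<integral>\<^sup>+\<theta>. primitive G (\<rho> \<theta>) \<theta> \<partial>sphere_measure) < \<infinity>"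
proof -
  have "(\<integral>\<^sup>+\<theta>. primitive G (\<rho> \<theta>) \<theta> \<partial>sphere_measure) \<le> (\<integral>\<^sup>+\<theta>. primitive G (max B 1) \<theta> \<partial>sphere_measure)"
  proof (intro nn_integral_mono)
    fix \<theta> :: 'a assume "\<theta> \<in> space sphere_measure"
    then show "primitive G (\<rho> \<theta>) \<theta> \<le> primitive G (max B 1) \<theta>"
      using assms[of \<theta>] by (intro primitive_mono) simp
  qed
  also have "\<dots> < \<infinity>" by (rule integral_primitive_finite) simp
  finally show ?thesis .
qed

lemma affine_on_ray_iff:
  assumes \<theta>: "\<theta> \<in> sphere 0 1"
  shows "affine_on_ray L f \<theta> \<longleftrightarrow> (\<forall>r. 0 \<le> r \<longrightarrow> r < radial L \<theta> \<longrightarrow> f r \<theta> = f 0 \<theta> * (1 - r / radial L \<theta>))"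
proof -
  have "sgn \<theta> = \<theta>" using \<theta> by (simp add: sgn_div_norm)
  then have "roof L (r *\<^sub>R \<theta>) = 1 - r / radial L \<theta>" if "0 \<le> r" "r < radial L \<theta>" for r
    using that \<theta> by (cases "r = 0") (auto simp: roof_def sgn_scaleR)
  then have "f r \<theta> = f 0 \<theta> * (1 - inverse (radial L \<theta>) * r) \<and> f r \<theta> = f 0 \<theta> * roof L (r *\<^sub>R \<theta>)
      \<longleftrightarrow> f r \<theta> = f 0 \<theta> * (1 - r / radial L \<theta>)" if "0 \<le> r" "r < radial L \<theta>" for r
    using that by (simp add: divide_inverse mult.commute)
  then show ?thesis
    unfolding affine_on_ray_def Ball_def atLeastLessThan_iff by blast
qed

text \<open>The defining identities pass to limits of directions.  The radius bounds are strict open conditions only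
inside \<open>(0, radial L \<theta>)\<close>, so the end point is reached afterwards by scaling both radii by \<open>s < 1\<close>.\<close>

lemma homogeneous_upto_AE_imp_all:
  assumes AE: "AE \<theta> in sphere_measure. homogeneous_upto G \<alpha> (radial L \<theta>) \<theta>" and \<theta>: "\<theta> \<in> sphere 0 1"
  shows "homogeneous_upto G \<alpha> (radial L \<theta>) \<theta>"
proof -
  obtain X where X: "\<And>n. X n \<in> sphere 0 1" "\<And>n. homogeneous_upto G \<alpha> (radial L (X n)) (X n)" "X \<longlonglongrightarrow> \<theta>"
    by (rule AE_sphere_sequence[OF AE \<theta>]) blast
  have \<rho>: "(\<lambda>n. radial L (X n)) \<longlonglongrightarrow> radial L \<theta>"
    using continuous_on_tendsto_compose[OF continuous_on_radial[OF L_body] X(3) \<theta>] X(1) by simp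
  have G_lim: "(\<lambda>n. G r (X n)) \<longlonglongrightarrow> G r \<theta>" if "r > 0" for r
  proof -
    have "(\<lambda>n. (r, X n)) \<longlonglongrightarrow> (r, \<theta>)" by (intro tendsto_intros X)
    from continuous_on_tendsto_compose[OF G_cont this] show ?thesis using that \<theta> X(1) by simp
  qed
  have inner: "G (u * r) \<theta> = u powr \<alpha> * G r \<theta>"
    if "0 < r" "r < radial L \<theta>" "0 < u" "u * r < radial L \<theta>" for r u
  proof -
    have "eventually (\<lambda>n. r < radial L (X n)) sequentially" "eventually (\<lambda>n. u * r < radial L (X n)) sequentially"
      using \<rho> that by (auto intro: order_tendstoD)
    then have "eventually (\<lambda>n. G (u * r) (X n) = u powr \<alpha> * G r (X n)) sequentially"
    proof eventually_elim
      case (elim n)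
      then show ?case using X(2)[of n] that unfolding homogeneous_upto_def by auto
    qed
    moreover have "(\<lambda>n. u powr \<alpha> * G r (X n)) \<longlonglongrightarrow> u powr \<alpha> * G r \<theta>"
      using that by (intro tendsto_intros G_lim)
    ultimately have "(\<lambda>n. G (u * r) (X n)) \<longlonglongrightarrow> u powr \<alpha> * G r \<theta>"
      by (simp add: tendsto_cong)
    moreover have "(\<lambda>n. G (u * r) (X n)) \<longlonglongrightarrow> G (u * r) \<theta>" using that by (intro G_lim) simp
    ultimately show ?thesis by (intro LIMSEQ_unique)
  qed
  show ?thesis
    unfolding homogeneous_upto_def
  proof (intro allI impI)
    fix r u :: real assume ru: "0 < r" "r \<le> radial L \<theta>" "0 < u" "u * r \<le> radial L \<theta>"
    have lim: "((\<lambda>s. G (s * t) \<theta>) \<longlongrightarrow> G t \<theta>) (at_left 1)" if "t > 0" for t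
    proof -
      have "((\<lambda>s. s * t) \<longlongrightarrow> 1 * t) (at_left 1)" by (intro tendsto_intros)
      moreover have "eventually (\<lambda>s. s * t \<in> {0<..}) (at_left (1::real))"
        using that by (intro eventually_at_leftI[of 0]) auto
      moreover have "1 * t \<in> {0<..}" using that by simp
      ultimately have "((\<lambda>s. G (s * t) \<theta>) \<longlongrightarrow> G (1 * t) \<theta>) (at_left 1)"
        by (intro continuous_on_tendsto_compose[OF weighted_ray.G_cont[OF weighted_ray[OF \<theta>]]])
      then show ?thesis by simp
    qed
    have "eventually (\<lambda>s. G (s * (u * r)) \<theta> = u powr \<alpha> * G (s * r) \<theta>) (at_left 1)"
    proof (rule eventually_at_leftI)
      fix s :: real assume s: "s \<in> {0<..<1}"
      then have "s * r < r" "s * (u * r) < u * r" using ru by simp_all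
      moreover have "u * (s * r) = s * (u * r)" by simp
      ultimately have "s * r < radial L \<theta>" "u * (s * r) < radial L \<theta>" using ru(2,4) by linarith+
      then show "G (s * (u * r)) \<theta> = u powr \<alpha> * G (s * r) \<theta>"
        using inner[of "s * r" u] s ru by (simp add: mult_ac)
    qed simp
    moreover have "((\<lambda>s. u powr \<alpha> * G (s * r) \<theta>) \<longlongrightarrow> u powr \<alpha> * G r \<theta>) (at_left 1)"
      using ru by (intro tendsto_intros lim)
    ultimately have "((\<lambda>s. G (s * (u * r)) \<theta>) \<longlongrightarrow> u powr \<alpha> * G r \<theta>) (at_left 1)"
      by (simp add: tendsto_cong)
    moreover have "((\<lambda>s. G (s * (u * r)) \<theta>) \<longlongrightarrow> G (u * r) \<theta>) (at_left 1)"
      using ru by (intro lim) simp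
    ultimately show "G (u * r) \<theta> = u powr \<alpha> * G r \<theta>"
      using tendsto_unique trivial_limit_at_left_real by blast
  qed
qed

lemma polar_integral_sphere:
  "polar_integral (sphere 0 1) \<rho> F = (\<integral>\<^sup>+\<theta>. primitive F (\<rho> \<theta>) \<theta> \<partial>(sphere_measure :: 'a measure))"
  unfolding polar_integral_def by (intro nn_integral_cong) simp

lemma dim_mult_gen_dual_volume:
  "of_nat DIM('a) * b * gen_dual_volume G K = b * (\<integral>\<^sup>+\<theta>. primitive G (radial K \<theta>) \<theta> \<partial>(sphere_measure :: 'a measure))"
proof -
  have "of_nat DIM('a) * ennreal (1 / real DIM('a)) = 1"
    by (simp add: ennreal_of_nat_eq_real_of_nat ennreal_mult[symmetric])
  moreover have "of_nat DIM('a) * b * (ennreal (1 / real DIM('a)) * X)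
      = of_nat DIM('a) * ennreal (1 / real DIM('a)) * (b * X)" for X
    by (simp only: mult_ac)
  ultimately show ?thesis unfolding gen_dual_volume_def by simp
qed

abbreviation ray_mass :: "'a \<Rightarrow> ennreal" where
  "ray_mass \<theta> \<equiv> primitive (\<lambda>r \<theta>. h (f r \<theta>) * G r \<theta>) (radial L \<theta>) \<theta>"

abbreviation flat_mass :: "'a \<Rightarrow> ennreal" where
  "flat_mass \<theta> \<equiv> primitive (\<lambda>r \<theta>. h (f 0 \<theta>) * G r \<theta>) (radial L \<theta>) \<theta>"

abbreviation tilde_mass :: "'a \<Rightarrow> ennreal" where
  "tilde_mass \<theta> \<equiv> primitive G (radial_tilde f \<theta>) \<theta>"

text \<open>The density on the sphere whose integral is the right-hand side of the upper bound, so that this bound and its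
equality case can be read off direction by direction.\<close>

definition upper_density :: "'a \<Rightarrow> ennreal" where
  "upper_density \<theta> = (if \<theta> \<in> Omega f then flat_mass \<theta> else beta_b \<alpha> h f * tilde_mass \<theta>)"

abbreviation tilde_body :: "'a set" where
  "tilde_body \<equiv> radial_body (radial_tilde f)"

lemma ray_mass_meas [measurable]: "ray_mass \<in> borel_measurable sphere_measure"
  by (intro borel_measurable_primitive integrand_meas f_meas f_nonneg radial_meas)

lemma radial_primitive_meas [measurable]:
  "(\<lambda>\<theta>. primitive G (radial L \<theta>) \<theta>) \<in> borel_measurable sphere_measure"
  by (intro borel_measurable_primitive G_meas radial_meas)

lemma integral_radial_primitive_finite: "(\<integral>\<^sup>+\<theta>. primitive G (radial L \<theta>) \<theta> \<partial>sphere_measure) < \<infinity>"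
  using radial_bounded[OF L_body] integral_primitive_bounded_finite by blast

lemma f0_nonneg: "\<theta> \<in> sphere 0 1 \<Longrightarrow> 0 \<le> f 0 \<theta>"
  by (rule f_nonneg) simp_all

lemma sphere_nonempty: "sphere (0::'a) 1 \<noteq> {}"
  by simp

lemma beta_a_le: "\<theta> \<in> sphere 0 1 \<Longrightarrow> beta_a \<alpha> h f \<le> beta_term \<alpha> h (f 0 \<theta>)"
  unfolding beta_a_def by (rule INF_lower)

lemma beta_a_finite: "beta_a \<alpha> h f < top"
proof -
  obtain \<theta> :: 'a where \<theta>: "\<theta> \<in> sphere 0 1" using sphere_nonempty by blast
  show ?thesis using beta_a_le[OF \<theta>] beta_term_finite[OF f0_nonneg[OF \<theta>]] by (rule order_le_less_trans)
qed

text \<open>As \<open>beta_term\<close> is strictly increasing in \<open>c\<close>, a direction attains the infimum of the constants exactly if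
it attains the infimum of \<open>f 0\<close>.\<close>

lemma beta_a_attained_iff:
  assumes h: "strict_mono_on {0..} h" and \<theta>: "\<theta> \<in> sphere 0 1"
  shows "beta_term \<alpha> h (f 0 \<theta>) = beta_a \<alpha> h f \<longleftrightarrow> ennreal (f 0 \<theta>) = (INF \<phi>\<in>sphere 0 1. ennreal (f 0 \<phi>))"
proof
  assume eq: "beta_term \<alpha> h (f 0 \<theta>) = beta_a \<alpha> h f"
  have "f 0 \<theta> \<le> f 0 \<phi>" if \<phi>: "\<phi> \<in> sphere 0 1" for \<phi>
  proof (rule ccontr)
    assume "\<not> ?thesis"
    then have "beta_term \<alpha> h (f 0 \<phi>) < beta_term \<alpha> h (f 0 \<theta>)"
      by (intro beta_term_strict_mono[OF h] f0_nonneg[OF \<phi>]) simp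
    then show False using beta_a_le[OF \<phi>] eq by simp
  qed
  then show "ennreal (f 0 \<theta>) = (INF \<phi>\<in>sphere 0 1. ennreal (f 0 \<phi>))"
    by (intro antisym INF_greatest INF_lower \<theta> ennreal_leI)
next
  assume eq: "ennreal (f 0 \<theta>) = (INF \<phi>\<in>sphere 0 1. ennreal (f 0 \<phi>))"
  have "f 0 \<theta> \<le> f 0 \<phi>" if \<phi>: "\<phi> \<in> sphere 0 1" for \<phi>
    using INF_lower[OF \<phi>, of "\<lambda>\<phi>. ennreal (f 0 \<phi>)"] f0_nonneg[OF \<phi>] unfolding eq[symmetric]
    by (simp add: ennreal_le_iff)
  then have "beta_term \<alpha> h (f 0 \<theta>) \<le> beta_a \<alpha> h f"
    unfolding beta_a_def by (intro INF_greatest beta_term_mono f0_nonneg \<theta>)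
  then show "beta_term \<alpha> h (f 0 \<theta>) = beta_a \<alpha> h f" using beta_a_le[OF \<theta>] by simp
qed

lemma beta_b_ge: "\<theta> \<in> sphere 0 1 - Omega f \<Longrightarrow> beta_term \<alpha> h (f 0 \<theta>) \<le> beta_b \<alpha> h f"
  unfolding beta_b_def by (rule SUP_upper)

lemma beta_b_attained_iff:
  assumes h: "strict_mono_on {0..} h" and \<theta>: "\<theta> \<in> sphere 0 1 - Omega f"
  shows "beta_term \<alpha> h (f 0 \<theta>) = beta_b \<alpha> h f
    \<longleftrightarrow> ennreal (f 0 \<theta>) = (SUP \<phi>\<in>sphere 0 1 - Omega f. ennreal (f 0 \<phi>))"
proof
  assume eq: "beta_term \<alpha> h (f 0 \<theta>) = beta_b \<alpha> h f"
  have "f 0 \<phi> \<le> f 0 \<theta>" if \<phi>: "\<phi> \<in> sphere 0 1 - Omega f" for \<phi>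
  proof (rule ccontr)
    assume "\<not> ?thesis"
    then have "beta_term \<alpha> h (f 0 \<theta>) < beta_term \<alpha> h (f 0 \<phi>)"
      using \<theta> by (intro beta_term_strict_mono[OF h] f0_nonneg) auto
    then show False using beta_b_ge[OF \<phi>] eq by simp
  qed
  then show "ennreal (f 0 \<theta>) = (SUP \<phi>\<in>sphere 0 1 - Omega f. ennreal (f 0 \<phi>))"
    by (intro antisym SUP_least SUP_upper \<theta> ennreal_leI)
next
  assume eq: "ennreal (f 0 \<theta>) = (SUP \<phi>\<in>sphere 0 1 - Omega f. ennreal (f 0 \<phi>))"
  have "f 0 \<phi> \<le> f 0 \<theta>" if \<phi>: "\<phi> \<in> sphere 0 1 - Omega f" for \<phi>
    using SUP_upper[OF \<phi>, of "\<lambda>\<phi>. ennreal (f 0 \<phi>)"] f0_nonneg \<theta> unfolding eq[symmetric]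
    by (simp add: ennreal_le_iff)
  then have "beta_b \<alpha> h f \<le> beta_term \<alpha> h (f 0 \<theta>)"
    unfolding beta_b_def by (intro SUP_least beta_term_mono f0_nonneg) auto
  then show "beta_term \<alpha> h (f 0 \<theta>) = beta_b \<alpha> h f" using beta_b_ge[OF \<theta>] by simp
qed

section \<open>The lower bound and its equality case\<close>

lemma lower_bound_eq_integral:
  "of_nat DIM('a) * beta_a \<alpha> h f * gen_dual_volume G L
    = (\<integral>\<^sup>+\<theta>. beta_a \<alpha> h f * primitive G (radial L \<theta>) \<theta> \<partial>sphere_measure)"
  by (simp add: dim_mult_gen_dual_volume nn_integral_cmult)

lemma lower_bound_eq:
  assumes h: "strict_mono_on {0..} h"
    and hom: "\<forall>\<theta>\<in>sphere 0 1. homogeneous_upto G \<alpha> (radial L \<theta>) \<theta>"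
    and const: "const_ae_inf (sphere 0 1) (f 0)"
    and affine: "AE \<theta> in sphere_measure. affine_on_ray L f \<theta>"
  shows "(\<integral>\<^sup>+\<theta>. ray_mass \<theta> \<partial>sphere_measure) = of_nat DIM('a) * beta_a \<alpha> h f * gen_dual_volume G L"
  unfolding lower_bound_eq_integral
proof (rule nn_integral_cong_AE, rule AE_mp[OF AE_conjI[OF const[unfolded const_ae_inf_def] affine]],
    intro AE_I2 impI)
  fix \<theta> :: 'a assume "\<theta> \<in> space sphere_measure"
  then have \<theta>: "\<theta> \<in> sphere 0 1" by simp
  assume *: "(\<theta> \<in> sphere 0 1 \<longrightarrow> ennreal (f 0 \<theta>) = (INF \<phi>\<in>sphere 0 1. ennreal (f 0 \<phi>))) \<and> affine_on_ray L f \<theta>"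
  then have b: "beta_term \<alpha> h (f 0 \<theta>) = beta_a \<alpha> h f"
    using \<theta> by (simp only: beta_a_attained_iff[OF h \<theta>])
  have "ray_mass \<theta> = beta_term \<alpha> h (f 0 \<theta>) * primitive G (radial L \<theta>) \<theta>"
    unfolding primitive_def[of "\<lambda>r \<theta>. h (f r \<theta>) * G r \<theta>"]
    using * hom \<theta> unfolding affine_on_ray_iff[OF \<theta>]
    by (intro weighted_ray.ray_integral_roof_homogeneous[OF weighted_ray[OF \<theta>] radial_pos[OF \<theta>],
          where \<phi> = "\<lambda>r. f r \<theta>"] f0_nonneg) blast+
  then show "ray_mass \<theta> = beta_a \<alpha> h f * primitive G (radial L \<theta>) \<theta>" unfolding b .
qed

context
  assumes G_lower: "\<And>\<theta> r u. \<theta> \<in> sphere 0 1 \<Longrightarrow> r > 0 \<Longrightarrow> 0 < u \<Longrightarrow> u \<le> 1 \<Longrightarrow> G (u * r) \<theta> \<ge> u powr \<alpha> * G r \<theta>"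
begin

lemma ray_mass_ge:
  assumes \<theta>: "\<theta> \<in> sphere 0 1"
  shows "beta_term \<alpha> h (f 0 \<theta>) * primitive G (radial L \<theta>) \<theta> \<le> ray_mass \<theta>"
  unfolding primitive_def[of "\<lambda>r \<theta>. h (f r \<theta>) * G r \<theta>"]
  by (rule weighted_ray.ray_integral_ge[OF weighted_ray[OF \<theta>] radial_pos[OF \<theta>] f_concave[OF \<theta>]])
    (use \<theta> f_nonneg G_lower in auto)

lemma ray_mass_ge_beta_a:
  assumes \<theta>: "\<theta> \<in> sphere 0 1"
  shows "beta_a \<alpha> h f * primitive G (radial L \<theta>) \<theta> \<le> ray_mass \<theta>"
  using mult_right_mono[OF beta_a_le[OF \<theta>]] ray_mass_ge[OF \<theta>] by (rule order_trans) simp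

lemma lower_bound:
  "of_nat DIM('a) * beta_a \<alpha> h f * gen_dual_volume G L \<le> (\<integral>\<^sup>+\<theta>. ray_mass \<theta> \<partial>sphere_measure)"
  unfolding lower_bound_eq_integral by (intro nn_integral_mono ray_mass_ge_beta_a) simp

text \<open>The right-hand side is finite, so equality holds in almost every direction, in each of the
inequalities \<open>beta_a \<alpha> h f * P \<le> beta_term \<alpha> h (f 0 \<theta>) * P \<le> ray_mass \<theta>\<close>, where
\<open>P = primitive G (radial L \<theta>) \<theta>\<close> is positive and almost everywhere finite.  The common value of \<open>f 0\<close>
is positive, for otherwise the affine profiles would vanish in almost every direction.\<close>

lemma lower_bound_eq_imp:
  assumes h: "strict_mono_on {0..} h"
    and nontriv: "\<not> (AE \<theta> in sphere_measure. \<forall>r\<in>{0..<radial L \<theta>}. f r \<theta> = 0)"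
    and eq: "(\<integral>\<^sup>+\<theta>. ray_mass \<theta> \<partial>sphere_measure) = of_nat DIM('a) * beta_a \<alpha> h f * gen_dual_volume G L"
  shows "\<forall>\<theta>\<in>sphere 0 1. homogeneous_upto G \<alpha> (radial L \<theta>) \<theta>"
    and "const_ae_inf (sphere 0 1) (f 0)"
    and "AE \<theta> in sphere_measure. affine_on_ray L f \<theta>"
proof -
  let ?P = "\<lambda>\<theta>. primitive G (radial L \<theta>) \<theta>"
  have fin: "(\<integral>\<^sup>+\<theta>. beta_a \<alpha> h f * ?P \<theta> \<partial>sphere_measure) < \<infinity>"
    using beta_a_finite integral_radial_primitive_finite by (simp add: nn_integral_cmult ennreal_mult_less_top)
  have "AE \<theta> in sphere_measure. beta_a \<alpha> h f * ?P \<theta> = ray_mass \<theta>"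
    using eq fin ray_mass_ge_beta_a unfolding lower_bound_eq_integral
    by (intro nn_integral_le_eq_imp_AE_eq) auto
  moreover have "AE \<theta> in sphere_measure. ?P \<theta> \<noteq> \<infinity>"
    using integral_radial_primitive_finite by (intro nn_integral_noteq_infinite) auto
  ultimately have key: "AE \<theta> in sphere_measure.
      ennreal (f 0 \<theta>) = (INF \<phi>\<in>sphere 0 1. ennreal (f 0 \<phi>)) \<and> affine_on_ray L f \<theta> \<and>
      (f 0 \<theta> > 0 \<longrightarrow> homogeneous_upto G \<alpha> (radial L \<theta>) \<theta>)"
  proof (rule AE_mp[OF AE_conjI], intro AE_I2 impI)
    fix \<theta> :: 'a assume "\<theta> \<in> space sphere_measure"
    then have \<theta>: "\<theta> \<in> sphere 0 1" by simp
    assume "beta_a \<alpha> h f * ?P \<theta> = ray_mass \<theta> \<and> ?P \<theta> \<noteq> \<infinity>"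
    then have m: "ray_mass \<theta> = beta_a \<alpha> h f * ?P \<theta>" and P_fin: "?P \<theta> < \<infinity>" by (auto simp: less_top)
    interpret ray: weighted_ray h \<alpha> G \<theta> by (rule weighted_ray[OF \<theta>])
    have P_pos: "?P \<theta> > 0" using ray.primitive_pos radial_pos[OF \<theta>] .
    have "beta_term \<alpha> h (f 0 \<theta>) * ?P \<theta> \<le> beta_a \<alpha> h f * ?P \<theta>"
      using ray_mass_ge[OF \<theta>] m by simp
    then have b: "beta_term \<alpha> h (f 0 \<theta>) = beta_a \<alpha> h f"
      using P_pos P_fin beta_a_le[OF \<theta>] ennreal_mult_le_mult_iff[of "?P \<theta>"]
      by (intro antisym) (auto simp: mult.commute)
    have eq': "ray.ray_integral (radial L \<theta>) (\<lambda>r. f r \<theta>) = beta_term \<alpha> h (f 0 \<theta>) * ?P \<theta>"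
      unfolding b m[symmetric] by (simp add: primitive_def)
    note * = ray.ray_integral_ge_eq[OF radial_pos[OF \<theta>] f_concave[OF \<theta>] f_nonneg[OF _ \<theta>]
        G_lower[OF \<theta>] h P_fin eq']
    show "ennreal (f 0 \<theta>) = (INF \<phi>\<in>sphere 0 1. ennreal (f 0 \<phi>)) \<and> affine_on_ray L f \<theta> \<and>
      (f 0 \<theta> > 0 \<longrightarrow> homogeneous_upto G \<alpha> (radial L \<theta>) \<theta>)"
      using b *(2) unfolding beta_a_attained_iff[OF h \<theta>] affine_on_ray_iff[OF \<theta>]
      by (intro conjI allI impI *(1)) simp_all
  qed
  then show "const_ae_inf (sphere 0 1) (f 0)" unfolding const_ae_inf_def
    by (rule eventually_mono) simp
  show "AE \<theta> in sphere_measure. affine_on_ray L f \<theta>" using key by (rule eventually_mono) simp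
  have "(INF \<phi>\<in>sphere 0 1. ennreal (f 0 \<phi>)) \<noteq> 0"
  proof
    assume zero: "(INF \<phi>\<in>sphere 0 1. ennreal (f 0 \<phi>)) = 0"
    have "AE \<theta> in sphere_measure. \<forall>r\<in>{0..<radial L \<theta>}. f r \<theta> = 0"
      using key
    proof (rule AE_mp, intro AE_I2 impI)
      fix \<theta> :: 'a assume "\<theta> \<in> space sphere_measure"
      then have \<theta>: "\<theta> \<in> sphere 0 1" by simp
      assume "ennreal (f 0 \<theta>) = (INF \<phi>\<in>sphere 0 1. ennreal (f 0 \<phi>)) \<and> affine_on_ray L f \<theta> \<and>
        (f 0 \<theta> > 0 \<longrightarrow> homogeneous_upto G \<alpha> (radial L \<theta>) \<theta>)"
      then have "f 0 \<theta> = 0" "affine_on_ray L f \<theta>"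
        using f0_nonneg[OF \<theta>] unfolding zero by (auto simp: ennreal_eq_0_iff)
      then show "\<forall>r\<in>{0..<radial L \<theta>}. f r \<theta> = 0" unfolding affine_on_ray_def by simp
    qed
    then show False using nontriv by simp
  qed
  then have "AE \<theta> in sphere_measure. homogeneous_upto G \<alpha> (radial L \<theta>) \<theta>"
    using key by (elim eventually_mono) (metis ennreal_neg not_less)
  then show "\<forall>\<theta>\<in>sphere 0 1. homogeneous_upto G \<alpha> (radial L \<theta>) \<theta>"
    using homogeneous_upto_AE_imp_all by blast
qed

end

section \<open>Tangents at the origin\<close>

lemma flat_mass_meas [measurable]: "flat_mass \<in> borel_measurable sphere_measure"
proof (intro borel_measurable_primitive integrand_meas radial_meas f0_nonneg)
  have [measurable]: "f 0 \<in> borel_measurable sphere_measure" using f_slice_meas[of 0] by simp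
  show "(\<lambda>(r, \<theta>). f 0 \<theta>) \<in> borel_measurable (restrict_space borel {0::real..} \<Otimes>\<^sub>M sphere_measure)"
    by measurable
qed

lemma ray_mass_eq_tilde:
  assumes h: "strict_mono_on {0..} h" and \<theta>: "\<theta> \<in> sphere 0 1 - Omega f"
    and "ennreal (f 0 \<theta>) = (SUP \<phi>\<in>sphere 0 1 - Omega f. ennreal (f 0 \<phi>))"
    and tilde: "radial_tilde f \<theta> = radial L \<theta>" and affine: "affine_on_ray L f \<theta>"
    and hom: "homogeneous_upto G \<alpha> (radial L \<theta>) \<theta>"
  shows "ray_mass \<theta> = upper_density \<theta>"
proof -
  have S: "\<theta> \<in> sphere 0 1" using \<theta> by simp
  have "ray_mass \<theta> = beta_term \<alpha> h (f 0 \<theta>) * primitive G (radial L \<theta>) \<theta>"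
    unfolding primitive_def[of "\<lambda>r \<theta>. h (f r \<theta>) * G r \<theta>"]
    using affine hom unfolding affine_on_ray_iff[OF S]
    by (intro weighted_ray.ray_integral_roof_homogeneous[OF weighted_ray[OF S] radial_pos[OF S],
          where \<phi> = "\<lambda>r. f r \<theta>"] f0_nonneg S) blast+
  moreover have "beta_term \<alpha> h (f 0 \<theta>) = beta_b \<alpha> h f"
    using assms(3) by (simp only: beta_b_attained_iff[OF h \<theta>])
  ultimately show ?thesis using \<theta> tilde by (simp add: upper_density_def)
qed

lemma ray_mass_eq_flat:
  assumes "\<theta> \<in> Omega f" "\<forall>r\<in>{0..<radial L \<theta>}. f r \<theta> = f 0 \<theta>"
  shows "ray_mass \<theta> = upper_density \<theta>"
proof -
  have "ray_mass \<theta> = flat_mass \<theta>"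
    unfolding primitive_def
  proof (intro nn_integral_cong)
    fix r
    show "ennreal (h (f r \<theta>) * G r \<theta>) * indicator {0<..<radial L \<theta>} r
        = ennreal (h (f 0 \<theta>) * G r \<theta>) * indicator {0<..<radial L \<theta>} r"
      using assms(2)[rule_format, of r] by (cases "r \<in> {0<..<radial L \<theta>}") simp_all
  qed
  then show ?thesis using assms(1) by (simp add: upper_density_def)
qed

context
  assumes f_max: "\<And>\<theta> r. \<theta> \<in> sphere 0 1 \<Longrightarrow> 0 \<le> r \<Longrightarrow> r < radial L \<theta> \<Longrightarrow> f r \<theta> \<le> f 0 \<theta>"
begin

lemma deriv_at_0:
  assumes \<theta>: "\<theta> \<in> sphere 0 1"
  shows "((\<lambda>r. f r \<theta>) has_vector_derivative deriv_at_0 f \<theta>) (at_right 0)" "deriv_at_0 f \<theta> \<le> 0"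
    "\<And>r. 0 \<le> r \<Longrightarrow> r < radial L \<theta> \<Longrightarrow> f r \<theta> \<le> f 0 \<theta> + deriv_at_0 f \<theta> * r"
proof -
  obtain d where d: "((\<lambda>r. f r \<theta>) has_vector_derivative d) (at_right 0)" "d \<le> 0"
    "\<And>r. 0 \<le> r \<Longrightarrow> r < radial L \<theta> \<Longrightarrow> f r \<theta> \<le> f 0 \<theta> + d * r"
    by (rule concave_max_at_0_derivative[OF f_concave[OF \<theta>] radial_pos[OF \<theta>] f_max[OF \<theta>]])
      blast+
  moreover have "deriv_at_0 f \<theta> = d"
    unfolding deriv_at_0_def by (rule vector_derivative_within[OF _ d(1)]) simp
  ultimately show "((\<lambda>r. f r \<theta>) has_vector_derivative deriv_at_0 f \<theta>) (at_right 0)" "deriv_at_0 f \<theta> \<le> 0"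
    "\<And>r. 0 \<le> r \<Longrightarrow> r < radial L \<theta> \<Longrightarrow> f r \<theta> \<le> f 0 \<theta> + deriv_at_0 f \<theta> * r"
    by simp_all
qed

lemma deriv_at_0_neg: "\<theta> \<in> sphere 0 1 - Omega f \<Longrightarrow> deriv_at_0 f \<theta> < 0"
  using deriv_at_0(2)[of \<theta>] by (auto simp: Omega_def)

text \<open>The derivative is a pointwise limit of difference quotients along the sequence \<open>1 / (n + 1)\<close>, each measurable in \<open>\<theta>\<close>.\<close>

lemma deriv_at_0_meas [measurable]: "deriv_at_0 f \<in> borel_measurable sphere_measure"
proof (rule borel_measurable_LIMSEQ_real)
  fix \<theta> :: 'a assume "\<theta> \<in> space sphere_measure"
  then have \<theta>: "\<theta> \<in> sphere 0 1" by simp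
  have "((\<lambda>r. (f r \<theta> - f 0 \<theta>) / r) \<longlongrightarrow> deriv_at_0 f \<theta>) (at_right 0)"
    using deriv_at_0(1)[OF \<theta>]
    by (simp add: has_real_derivative_iff_has_vector_derivative[symmetric] has_field_derivative_iff)
  moreover have "filterlim (\<lambda>n. 1 / real (Suc n)) (at_right 0) sequentially"
    using LIMSEQ_Suc[OF lim_1_over_n] by (simp add: filterlim_at)
  ultimately show "(\<lambda>n. (f (1 / real (Suc n)) \<theta> - f 0 \<theta>) / (1 / real (Suc n))) \<longlonglongrightarrow> deriv_at_0 f \<theta>"
    by (rule filterlim_compose)
next
  show "(\<lambda>\<theta>. (f (1 / real (Suc n)) \<theta> - f 0 \<theta>) / (1 / real (Suc n))) \<in> borel_measurable sphere_measure" for n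
    by (intro borel_measurable_divide borel_measurable_diff f_slice_meas borel_measurable_const) auto
qed

lemma radial_tilde_meas [measurable]: "radial_tilde f \<in> borel_measurable sphere_measure"
proof -
  have [measurable]: "f 0 \<in> borel_measurable sphere_measure" using f_slice_meas[of 0] by simp
  show ?thesis unfolding radial_tilde_def[abs_def] by measurable
qed

lemma Omega_meas [measurable]: "Omega f \<in> sets sphere_measure"
proof -
  have "Omega f = {\<theta> \<in> space sphere_measure. deriv_at_0 f \<theta> = 0}" by (simp add: Omega_def)
  also have "\<dots> \<in> sets sphere_measure" by measurable
  finally show ?thesis .
qed

text \<open>The tangent at \<open>0\<close> dominates the non-negative profile up to \<open>radial L \<theta>\<close>.  It is decreasing and
vanishes at \<open>radial_tilde f \<theta>\<close>, which therefore lies beyond \<open>radial L \<theta>\<close>, and it starts at a positive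
value.\<close>

lemma radial_tilde:
  assumes \<theta>: "\<theta> \<in> sphere 0 1 - Omega f"
  shows "f 0 \<theta> > 0" "radial L \<theta> \<le> radial_tilde f \<theta>"
    "\<And>r. 0 \<le> r \<Longrightarrow> r < radial L \<theta> \<Longrightarrow> f r \<theta> \<le> f 0 \<theta> * (1 - r / radial_tilde f \<theta>)"
proof -
  let ?d = "deriv_at_0 f \<theta>"
  have S: "\<theta> \<in> sphere 0 1" using \<theta> by simp
  have d: "?d < 0" by (rule deriv_at_0_neg[OF \<theta>])
  have tangent: "0 \<le> f 0 \<theta> + ?d * r" if "0 \<le> r" "r < radial L \<theta>" for r
    using deriv_at_0(3)[OF S that] f_nonneg[OF that(1) S] by simp
  have "0 \<le> f 0 \<theta> + ?d * (radial L \<theta> / 2)" using radial_pos[OF S] by (intro tangent) auto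
  moreover have "?d * (radial L \<theta> / 2) < 0" using d radial_pos[OF S] by (simp add: mult_neg_pos)
  ultimately show pos: "f 0 \<theta> > 0" by linarith
  have t: "radial_tilde f \<theta> = f 0 \<theta> / (- ?d)"
    unfolding radial_tilde_def by (simp add: divide_inverse mult.commute)
  show "radial L \<theta> \<le> radial_tilde f \<theta>"
  proof (rule dense_le_bounded[OF radial_pos[OF S]])
    fix r assume r: "0 < r" "r < radial L \<theta>"
    have "r * (- ?d) \<le> f 0 \<theta>" using tangent[of r] r by (simp add: mult.commute)
    then show "r \<le> radial_tilde f \<theta>"
      unfolding t using d by (subst pos_le_divide_eq) auto
  qed
  show "f r \<theta> \<le> f 0 \<theta> * (1 - r / radial_tilde f \<theta>)" if "0 \<le> r" "r < radial L \<theta>" for r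
  proof -
    have "f 0 \<theta> * (1 - r / radial_tilde f \<theta>) = f 0 \<theta> + ?d * r"
      using pos d unfolding t by (simp add: field_simps)
    then show ?thesis using deriv_at_0(3)[OF S that] by simp
  qed
qed

lemma tilde_mass_meas [measurable]: "tilde_mass \<in> borel_measurable sphere_measure"
  by (intro borel_measurable_primitive G_meas radial_tilde_meas)

lemma upper_density_meas [measurable]: "upper_density \<in> borel_measurable sphere_measure"
  unfolding upper_density_def[abs_def] by measurable

lemma upper_bound_eq_integral:
  "beta_b \<alpha> h f * polar_integral (sphere 0 1 - Omega f) (radial_tilde f) G
     + polar_integral (Omega f) (radial L) (\<lambda>r \<theta>. h (f 0 \<theta>) * G r \<theta>)
   = (\<integral>\<^sup>+\<theta>. upper_density \<theta> \<partial>sphere_measure)"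
proof -
  have [measurable]: "sphere 0 1 - Omega f \<in> sets sphere_measure"
    using sets.compl_sets[OF Omega_meas] by simp
  have "(\<integral>\<^sup>+\<theta>. upper_density \<theta> \<partial>sphere_measure)
      = (\<integral>\<^sup>+\<theta>. beta_b \<alpha> h f * (tilde_mass \<theta> * indicator (sphere 0 1 - Omega f) \<theta>)
           + flat_mass \<theta> * indicator (Omega f) \<theta> \<partial>sphere_measure)"
    by (intro nn_integral_cong) (auto simp: upper_density_def indicator_def)
  also have "\<dots> = beta_b \<alpha> h f * (\<integral>\<^sup>+\<theta>. tilde_mass \<theta> * indicator (sphere 0 1 - Omega f) \<theta> \<partial>sphere_measure)
           + (\<integral>\<^sup>+\<theta>. flat_mass \<theta> * indicator (Omega f) \<theta> \<partial>sphere_measure)"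
    by (simp add: nn_integral_add nn_integral_cmult)
  finally show ?thesis by (simp add: polar_integral_def)
qed

lemma tangent_bound_context:
  assumes \<theta>: "\<theta> \<in> sphere 0 1 - Omega f"
  shows "0 < radial L \<theta>" "radial L \<theta> \<le> radial_tilde f \<theta>" "0 \<le> f 0 \<theta>"
    "concave_on {0..<radial L \<theta>} (\<lambda>r. f r \<theta>)"
    "\<And>r. 0 \<le> r \<Longrightarrow> r < radial L \<theta> \<Longrightarrow> 0 \<le> f r \<theta>"
  using \<theta> radial_pos radial_tilde f0_nonneg f_concave f_nonneg by auto

section \<open>The body bounded by the zeros of the tangents\<close>

context
  assumes Omega_empty: "Omega f = {}"
begin

lemma radial_tilde_ge:
  assumes "\<theta> \<in> sphere 0 1"
  shows "radial L \<theta> \<le> radial_tilde f \<theta>" "radial_tilde f \<theta> > 0"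
  using assms Omega_empty radial_tilde(2)[of \<theta>] radial_pos[of \<theta>] by auto

lemma radial_tilde_body: "\<theta> \<in> sphere 0 1 \<Longrightarrow> radial tilde_body \<theta> = radial_tilde f \<theta>"
  by (rule radial_radial_body[OF radial_tilde_ge(2)])

lemma subset_tilde_body: "L \<subseteq> tilde_body"
  by (subst convex_eq_radial_body[OF L_body]) (rule radial_body_mono[OF radial_tilde_ge(1)])

lemma tilde_volume_eq_upper:
  "of_nat DIM('a) * beta_b \<alpha> h f * gen_dual_volume G tilde_body = (\<integral>\<^sup>+\<theta>. upper_density \<theta> \<partial>sphere_measure)"
proof -
  have "of_nat DIM('a) * beta_b \<alpha> h f * gen_dual_volume G tilde_body
      = beta_b \<alpha> h f * (\<integral>\<^sup>+\<theta>. tilde_mass \<theta> \<partial>sphere_measure)"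
    unfolding dim_mult_gen_dual_volume
    by (intro arg_cong2[where f = "(*)"] nn_integral_cong refl) (simp add: radial_tilde_body)
  also have "\<dots> = (\<integral>\<^sup>+\<theta>. beta_b \<alpha> h f * tilde_mass \<theta> \<partial>sphere_measure)"
    by (simp add: nn_integral_cmult)
  also have "\<dots> = (\<integral>\<^sup>+\<theta>. upper_density \<theta> \<partial>sphere_measure)"
    by (simp add: upper_density_def Omega_empty)
  finally show ?thesis .
qed

lemma continuous_radial_tilde_body:
  assumes \<theta>: "\<theta> \<in> sphere 0 1"
    and cont: "continuous (at \<theta> within sphere 0 1) (f 0)"
      "continuous (at \<theta> within sphere 0 1) (deriv_at_0 f)"
  shows "continuous (at \<theta> within sphere 0 1) (radial tilde_body)"
proof -
  have "deriv_at_0 f \<theta> \<noteq> 0" using deriv_at_0_neg[of \<theta>] \<theta> Omega_empty by auto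
  then have "continuous (at \<theta> within sphere 0 1) (radial_tilde f)"
    unfolding radial_tilde_def[abs_def] using cont
    by (intro continuous_intros continuous_at_within_inverse) auto
  then show ?thesis
    by (rule continuous_transform_within[OF _ zero_less_one \<theta>]) (simp add: radial_tilde_body)
qed

context
  assumes f0_cont: "continuous_on (sphere 0 1) (f 0)"
    and deriv_cont: "continuous_on (sphere 0 1) (deriv_at_0 f)"
begin

lemma continuous_on_radial_tilde_body: "continuous_on (sphere 0 1) (radial tilde_body)"
  using f0_cont deriv_cont continuous_radial_tilde_body
  unfolding continuous_on_eq_continuous_within by blast

lemma continuous_on_radial_tilde: "continuous_on (sphere 0 1) (radial_tilde f)"
  using continuous_on_radial_tilde_body by (rule continuous_on_eq) (rule radial_tilde_body)

lemma star_body_tilde_body: "star_body tilde_body"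
  unfolding star_body_def
  using compact_radial_body[OF radial_tilde_ge(2) continuous_on_radial_tilde] star_shaped_radial_body
    interior_mono[OF subset_tilde_body] interior_L continuous_on_radial_tilde_body by blast

text \<open>Continuity on the compact sphere bounds \<open>f 0\<close>, hence \<open>beta_b\<close>, and it bounds \<open>radial_tilde f\<close>.\<close>

lemma upper_density_integral_finite: "(\<integral>\<^sup>+\<theta>. upper_density \<theta> \<partial>sphere_measure) < \<infinity>"
proof -
  have bounded_above: "\<exists>M. \<forall>\<theta>\<in>sphere 0 1. g \<theta> \<le> M" if g: "continuous_on (sphere 0 1) g" for g :: "'a \<Rightarrow> real"
  proof -
    obtain M where "\<forall>x\<in>g ` sphere 0 1. norm x \<le> M"
      using compact_imp_bounded[OF compact_continuous_image[OF g compact_sphere]]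
      unfolding bounded_iff by blast
    then have "\<forall>\<theta>\<in>sphere 0 1. g \<theta> \<le> M" by (auto simp: abs_le_iff)
    then show ?thesis ..
  qed
  obtain M where M: "\<And>\<theta>. \<theta> \<in> sphere 0 1 \<Longrightarrow> f 0 \<theta> \<le> M"
    using bounded_above[OF f0_cont] by blast
  obtain T where T: "\<And>\<theta>. \<theta> \<in> sphere 0 1 \<Longrightarrow> radial_tilde f \<theta> \<le> T"
    using bounded_above[OF continuous_on_radial_tilde] by blast
  have "beta_b \<alpha> h f \<le> beta_term \<alpha> h (max M 0)"
    unfolding beta_b_def using M f0_nonneg by (intro SUP_least beta_term_mono) (auto simp: le_max_iff_disj)
  then have "beta_b \<alpha> h f < top" using beta_term_finite[of "max M 0"] by simp
  then show ?thesis
    using integral_primitive_bounded_finite[of "radial_tilde f" T] T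
    by (simp add: upper_density_def Omega_empty nn_integral_cmult ennreal_mult_less_top)
qed

end

end

section \<open>The upper bound and its equality case\<close>

lemma ray_mass_le_flat:
  assumes S: "\<theta> \<in> sphere 0 1"
  shows "ray_mass \<theta> \<le> flat_mass \<theta>"
  unfolding primitive_def[of "\<lambda>r \<theta>. h (f r \<theta>) * G r \<theta>"] primitive_def[of "\<lambda>r \<theta>. h (f 0 \<theta>) * G r \<theta>"]
  by (rule weighted_ray.ray_integral_mono[OF weighted_ray[OF S], where \<psi> = "\<lambda>_. f 0 \<theta>"])
    (use f_nonneg f_max S in auto)

context
  assumes G_upper: "\<And>\<theta> r u. \<theta> \<in> sphere 0 1 \<Longrightarrow> r > 0 \<Longrightarrow> 0 < u \<Longrightarrow> u \<le> 1 \<Longrightarrow> G (u * r) \<theta> \<le> u powr \<alpha> * G r \<theta>"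
begin

lemma ray_mass_le_tilde:
  assumes \<theta>: "\<theta> \<in> sphere 0 1 - Omega f"
  shows "ray_mass \<theta> \<le> beta_term \<alpha> h (f 0 \<theta>) * tilde_mass \<theta>"
proof -
  have S: "\<theta> \<in> sphere 0 1" using \<theta> by simp
  note ctx = tangent_bound_context[OF \<theta>]
  show ?thesis
    using weighted_ray.ray_integral_le[OF weighted_ray[OF S] ctx(1,2), where \<phi> = "\<lambda>r. f r \<theta>",
        OF ctx(3) ctx(4) ctx(5) radial_tilde(3)[OF \<theta>] G_upper[OF S]]
    by (simp add: primitive_def[of "\<lambda>r \<theta>. h (f r \<theta>) * G r \<theta>"])
qed

lemma ray_mass_le:
  assumes S: "\<theta> \<in> sphere 0 1"
  shows "ray_mass \<theta> \<le> upper_density \<theta>"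
proof (cases "\<theta> \<in> Omega f")
  case True
  then show ?thesis using ray_mass_le_flat[OF S] by (simp add: upper_density_def)
next
  case False
  then have \<theta>: "\<theta> \<in> sphere 0 1 - Omega f" using S by simp
  have "ray_mass \<theta> \<le> beta_term \<alpha> h (f 0 \<theta>) * tilde_mass \<theta>" by (rule ray_mass_le_tilde[OF \<theta>])
  also have "\<dots> \<le> beta_b \<alpha> h f * tilde_mass \<theta>" by (intro mult_right_mono beta_b_ge \<theta>) simp
  finally show ?thesis using False by (simp add: upper_density_def)
qed

lemma upper_bound: "(\<integral>\<^sup>+\<theta>. ray_mass \<theta> \<partial>sphere_measure) \<le> (\<integral>\<^sup>+\<theta>. upper_density \<theta> \<partial>sphere_measure)"
  by (intro nn_integral_mono ray_mass_le) simp

text \<open>Off \<open>Omega f\<close>, the chain \<open>ray_mass \<theta> \<le> beta_term \<alpha> h (f 0 \<theta>) * tilde_mass \<theta> \<le> beta_b \<alpha> h f * tilde_mass \<theta>\<close>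
consists of equalities, and since all terms are finite and positive \<open>tilde_mass \<theta>\<close> may be cancelled.
On \<open>Omega f\<close>, the profile is compared with the constant \<open>f 0 \<theta>\<close>.\<close>

lemma ray_mass_eq_imp:
  assumes h: "strict_mono_on {0..} h" and S: "\<theta> \<in> sphere 0 1"
    and fin: "ray_mass \<theta> < \<infinity>" and eq: "ray_mass \<theta> = upper_density \<theta>"
  shows "\<theta> \<notin> Omega f \<Longrightarrow> ennreal (f 0 \<theta>) = (SUP \<phi>\<in>sphere 0 1 - Omega f. ennreal (f 0 \<phi>)) \<and>
      radial_tilde f \<theta> = radial L \<theta> \<and> affine_on_ray L f \<theta> \<and> homogeneous_upto G \<alpha> (radial L \<theta>) \<theta>"
    and "\<theta> \<in> Omega f \<Longrightarrow> \<forall>r\<in>{0..<radial L \<theta>}. f r \<theta> = f 0 \<theta>"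
proof -
  interpret ray: weighted_ray h \<alpha> G \<theta> by (rule weighted_ray[OF S])
  have m: "ray_mass \<theta> = ray.ray_integral (radial L \<theta>) (\<lambda>r. f r \<theta>)" by (simp add: primitive_def)
  show "ennreal (f 0 \<theta>) = (SUP \<phi>\<in>sphere 0 1 - Omega f. ennreal (f 0 \<phi>)) \<and>
      radial_tilde f \<theta> = radial L \<theta> \<and> affine_on_ray L f \<theta> \<and> homogeneous_upto G \<alpha> (radial L \<theta>) \<theta>"
    if "\<theta> \<notin> Omega f"
  proof -
    have \<theta>: "\<theta> \<in> sphere 0 1 - Omega f" using S that by simp
    note ctx = tangent_bound_context[OF \<theta>]
    have eq_b: "ray_mass \<theta> = beta_b \<alpha> h f * tilde_mass \<theta>" using eq that by (simp add: upper_density_def)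
    have P_pos: "tilde_mass \<theta> > 0" using ctx(1,2) by (intro ray.primitive_pos) simp
    \<comment> \<open>A positive factor \<open>beta_b\<close> rules out that \<open>tilde_mass \<theta>\<close> is infinite; \<open>beta_b\<close> itself may be infinite a priori.\<close>
    have "0 < beta_term \<alpha> h (f 0 \<theta>)"
      using beta_term_strict_mono[OF h order_refl radial_tilde(1)[OF \<theta>]] by (rule le_less_trans[rotated]) simp
    then have "0 < beta_b \<alpha> h f" using beta_b_ge[OF \<theta>] by (rule less_le_trans)
    then have P_fin: "tilde_mass \<theta> < \<infinity>"
      using fin unfolding eq_b by (auto simp: ennreal_mult_less_top)
    have "beta_b \<alpha> h f * tilde_mass \<theta> \<le> beta_term \<alpha> h (f 0 \<theta>) * tilde_mass \<theta>"
      using ray_mass_le_tilde[OF \<theta>] eq_b by simp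
    then have b: "beta_term \<alpha> h (f 0 \<theta>) = beta_b \<alpha> h f"
      using P_pos P_fin beta_b_ge[OF \<theta>] ennreal_mult_le_mult_iff[of "tilde_mass \<theta>"]
      by (intro antisym) (auto simp: mult.commute)
    note * = ray.ray_integral_le_eq[OF ctx(1,2), where \<phi> = "\<lambda>r. f r \<theta>",
        OF ctx(3) ctx(4) ctx(5) radial_tilde(3)[OF \<theta>] G_upper[OF S] h radial_tilde(1)[OF \<theta>] P_fin
          eq_b[folded b, unfolded m]]
    show ?thesis
      using *(1,3) b unfolding beta_b_attained_iff[OF h \<theta>] affine_on_ray_iff[OF S]
      by (intro conjI allI impI *(2)) simp_all
  qed
  show "\<forall>r\<in>{0..<radial L \<theta>}. f r \<theta> = f 0 \<theta>" if "\<theta> \<in> Omega f"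
  proof
    fix r assume r: "r \<in> {0..<radial L \<theta>}"
    have eq_flat: "ray.ray_integral (radial L \<theta>) (\<lambda>r. f r \<theta>) = ray.ray_integral (radial L \<theta>) (\<lambda>_. f 0 \<theta>)"
      using eq that unfolding m by (simp add: upper_density_def primitive_def)
    show "f r \<theta> = f 0 \<theta>"
    proof (cases "r = 0")
      case False
      show ?thesis
        by (rule ray.ray_integral_eq_imp_eq[OF h concave_continuous_on_Ioo[OF f_concave[OF S]]
              continuous_on_const _ _ eq_flat fin[unfolded m]])
          (use r False f_nonneg f_max S in auto)
    qed simp
  qed
qed

lemma upper_bound_eq_iff:
  assumes h: "strict_mono_on {0..} h" and fin: "(\<integral>\<^sup>+\<theta>. ray_mass \<theta> \<partial>sphere_measure) < \<infinity>"
  shows "(\<integral>\<^sup>+\<theta>. ray_mass \<theta> \<partial>sphere_measure) = (\<integral>\<^sup>+\<theta>. upper_density \<theta> \<partial>sphere_measure) \<longleftrightarrow>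
    const_ae_sup (sphere 0 1 - Omega f) (f 0) \<and>
    (AE \<theta> in sphere_measure. \<theta> \<notin> Omega f \<longrightarrow>
       radial_tilde f \<theta> = radial L \<theta> \<and> affine_on_ray L f \<theta> \<and> homogeneous_upto G \<alpha> (radial L \<theta>) \<theta>) \<and>
    (AE \<theta> in sphere_measure. \<theta> \<in> Omega f \<longrightarrow> (\<forall>r\<in>{0..<radial L \<theta>}. f r \<theta> = f 0 \<theta>))"
    (is "?eq \<longleftrightarrow> ?const \<and> ?affine \<and> ?flat")
proof
  assume eq: ?eq
  have "AE \<theta> in sphere_measure. ray_mass \<theta> = upper_density \<theta>"
    using eq fin ray_mass_le by (intro nn_integral_le_eq_imp_AE_eq) auto
  moreover have "AE \<theta> in sphere_measure. ray_mass \<theta> \<noteq> \<infinity>"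
    using fin by (intro nn_integral_noteq_infinite) auto
  ultimately have AE: "AE \<theta> in sphere_measure. (ray_mass \<theta> = upper_density \<theta> \<and> ray_mass \<theta> \<noteq> \<infinity>) \<and> \<theta> \<in> sphere 0 1"
    using AE_space[of "sphere_measure :: 'a measure"] by eventually_elim simp
  have "AE \<theta> in sphere_measure.
     (\<theta> \<notin> Omega f \<longrightarrow> ennreal (f 0 \<theta>) = (SUP \<phi>\<in>sphere 0 1 - Omega f. ennreal (f 0 \<phi>)) \<and>
       radial_tilde f \<theta> = radial L \<theta> \<and> affine_on_ray L f \<theta> \<and> homogeneous_upto G \<alpha> (radial L \<theta>) \<theta>) \<and>
     (\<theta> \<in> Omega f \<longrightarrow> (\<forall>r\<in>{0..<radial L \<theta>}. f r \<theta> = f 0 \<theta>))"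
    using AE
  proof (rule eventually_mono, intro conjI[OF impI impI])
    fix \<theta> :: 'a assume "(ray_mass \<theta> = upper_density \<theta> \<and> ray_mass \<theta> \<noteq> \<infinity>) \<and> \<theta> \<in> sphere 0 1"
    then have *: "\<theta> \<in> sphere 0 1" "ray_mass \<theta> < \<infinity>" "ray_mass \<theta> = upper_density \<theta>"
      unfolding less_top infinity_ennreal_def by blast+
    show "ennreal (f 0 \<theta>) = (SUP \<phi>\<in>sphere 0 1 - Omega f. ennreal (f 0 \<phi>)) \<and>
       radial_tilde f \<theta> = radial L \<theta> \<and> affine_on_ray L f \<theta> \<and> homogeneous_upto G \<alpha> (radial L \<theta>) \<theta>"
      if "\<theta> \<notin> Omega f" by (rule ray_mass_eq_imp(1)[OF h * that])
    show "\<forall>r\<in>{0..<radial L \<theta>}. f r \<theta> = f 0 \<theta>" if "\<theta> \<in> Omega f"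
      by (rule ray_mass_eq_imp(2)[OF h * that])
  qed
  then show "?const \<and> ?affine \<and> ?flat"
    unfolding const_ae_sup_def by (intro conjI; elim eventually_mono; blast)
next
  assume "?const \<and> ?affine \<and> ?flat"
  then have AE: "?const" "?affine" "?flat" by blast+
  show ?eq
  proof (rule nn_integral_cong_AE,
      rule AE_mp[OF AE_conjI[OF AE(1)[unfolded const_ae_sup_def] AE_conjI[OF AE(2,3)]]], intro AE_I2 impI)
    fix \<theta> :: 'a assume "\<theta> \<in> space sphere_measure"
    then have S: "\<theta> \<in> sphere 0 1" by simp
    assume *: "(\<theta> \<in> sphere 0 1 - Omega f \<longrightarrow> ennreal (f 0 \<theta>) = (SUP \<phi>\<in>sphere 0 1 - Omega f. ennreal (f 0 \<phi>))) \<and>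
      (\<theta> \<notin> Omega f \<longrightarrow> radial_tilde f \<theta> = radial L \<theta> \<and> affine_on_ray L f \<theta> \<and> homogeneous_upto G \<alpha> (radial L \<theta>) \<theta>) \<and>
      (\<theta> \<in> Omega f \<longrightarrow> (\<forall>r\<in>{0..<radial L \<theta>}. f r \<theta> = f 0 \<theta>))"
    show "ray_mass \<theta> = upper_density \<theta>"
    proof (cases "\<theta> \<in> Omega f")
      case True
      then show ?thesis using * by (intro ray_mass_eq_flat) blast+
    next
      case False
      then show ?thesis using * S by (intro ray_mass_eq_tilde[OF h]) blast+
    qed
  qed
qed

text \<open>The equality case makes the two radial functions agree in almost every direction, and continuity makes
them agree everywhere.\<close>

lemma tilde_body_eq:
  assumes empty: "Omega f = {}"
    and cont: "continuous_on (sphere 0 1) (f 0)" "continuous_on (sphere 0 1) (deriv_at_0 f)"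
    and h: "strict_mono_on {0..} h"
    and eq: "(\<integral>\<^sup>+\<theta>. ray_mass \<theta> \<partial>sphere_measure) = (\<integral>\<^sup>+\<theta>. upper_density \<theta> \<partial>sphere_measure)"
  shows "L = tilde_body"
proof -
  have fin: "(\<integral>\<^sup>+\<theta>. ray_mass \<theta> \<partial>sphere_measure) < \<infinity>"
    unfolding eq by (rule upper_density_integral_finite[OF empty cont])
  have AE: "AE \<theta> in sphere_measure. radial_tilde f \<theta> = radial L \<theta>"
    using upper_bound_eq_iff[OF h fin, THEN iffD1, OF eq] empty
    by (auto elim!: eventually_mono)
  have "radial_tilde f \<theta> = radial L \<theta>" if \<theta>: "\<theta> \<in> sphere 0 1" for \<theta>
  proof -
    obtain X where X: "\<And>n. X n \<in> sphere 0 1" "\<And>n. radial_tilde f (X n) = radial L (X n)" "X \<longlonglongrightarrow> \<theta>"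
      by (rule AE_sphere_sequence[OF AE \<theta>]) blast
    have "(\<lambda>n. radial_tilde f (X n)) \<longlonglongrightarrow> radial_tilde f \<theta>" "(\<lambda>n. radial L (X n)) \<longlonglongrightarrow> radial L \<theta>"
      using continuous_on_tendsto_compose[OF continuous_on_radial_tilde[OF empty cont] X(3) \<theta>]
        continuous_on_tendsto_compose[OF continuous_on_radial[OF L_body] X(3) \<theta>] X(1) by simp_all
    then show ?thesis unfolding X(2) by (rule LIMSEQ_unique)
  qed
  then have "tilde_body = radial_body (radial L)"
    by (intro equalityI radial_body_mono) simp_all
  then show ?thesis using convex_eq_radial_body[OF L_body] by simp
qed

end

end

end

theorem theorem5p1:
  fixes L :: "'a::euclidean_space set"
    and f G :: "real \<Rightarrow> 'a \<Rightarrow> real"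
    and h :: "real \<Rightarrow> real"
    and \<alpha> :: real
  assumes L: "convex_body L" "0 \<in> interior L"
    and f_nonneg: "\<And>r \<theta>. r \<ge> 0 \<Longrightarrow> \<theta> \<in> sphere 0 1 \<Longrightarrow> f r \<theta> \<ge> 0"
    and f_supp: "\<And>r \<theta>. \<theta> \<in> sphere 0 1 \<Longrightarrow> r > radial L \<theta> \<Longrightarrow> f r \<theta> = 0"
    and f_concave: "\<And>\<theta>. \<theta> \<in> sphere 0 1 \<Longrightarrow> concave_on {0..<radial L \<theta>} (\<lambda>t. f t \<theta>)"
    and f_meas: "(\<lambda>(r, \<theta>). f r \<theta>) \<in> borel_measurable (restrict_space borel {0..} \<Otimes>\<^sub>M sphere_measure)"
    and h_mono: "mono_on {0..} h"
    and h_nonneg: "\<And>x. x \<ge> 0 \<Longrightarrow> h x \<ge> 0"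
    and h_diff: "h differentiable_on {0..}"
    and G_pos: "\<And>r \<theta>. r > 0 \<Longrightarrow> \<theta> \<in> sphere 0 1 \<Longrightarrow> G r \<theta> > 0"
    and G_cont: "continuous_on ({0<..} \<times> sphere 0 1) (\<lambda>(r, \<theta>). G r \<theta>)"
    and G_int: "\<And>R. R > 0 \<Longrightarrow>
      (\<integral>\<^sup>+(r, \<theta>)\<in>{0<..<R} \<times> sphere 0 1. ennreal (G r \<theta>) \<partial>(lborel \<Otimes>\<^sub>M sphere_measure)) < \<infinity>"
    and \<alpha>: "\<alpha> > -1"
  defines "S \<equiv> sphere (0::'a) 1"
    and "I \<equiv> polar_integral (sphere (0::'a) 1) (radial L) (\<lambda>r \<theta>. h (f r \<theta>) * G r \<theta>)"
    and "RA \<equiv> of_nat DIM('a) * beta_a \<alpha> h f * gen_dual_volume G L"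
    and "RB \<equiv> beta_b \<alpha> h f * polar_integral (sphere 0 1 - Omega f) (radial_tilde f) G
             + polar_integral (Omega f) (radial L) (\<lambda>r \<theta>. h (f 0 \<theta>) * G r \<theta>)"
  shows
    "((\<forall>\<theta>\<in>S. \<forall>r u. r > 0 \<longrightarrow> 0 < u \<longrightarrow> u \<le> 1 \<longrightarrow> G (u * r) \<theta> \<ge> u powr \<alpha> * G r \<theta>) \<longrightarrow>
        I \<ge> RA \<and>
        (strict_mono_on {0..} h \<longrightarrow> \<not> (AE \<theta> in sphere_measure. \<forall>r\<in>{0..<radial L \<theta>}. f r \<theta> = 0) \<longrightarrow>
          (I = RA \<longleftrightarrow>
             (\<forall>\<theta>\<in>S. homogeneous_upto G \<alpha> (radial L \<theta>) \<theta>) \<and>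
             const_ae_inf S (f 0) \<and>
             (AE \<theta> in sphere_measure. affine_on_ray L f \<theta>)))) \<and>
     ((\<forall>\<theta>\<in>S. \<forall>r u. r > 0 \<longrightarrow> 0 < u \<longrightarrow> u \<le> 1 \<longrightarrow> G (u * r) \<theta> \<le> u powr \<alpha> * G r \<theta>) \<longrightarrow>
      (\<forall>\<theta>\<in>S. \<forall>r\<in>{0..radial L \<theta>}. f r \<theta> \<le> f 0 \<theta>) \<longrightarrow>
        I \<le> RB \<and>
        (Omega f = {} \<longrightarrow>
          (\<exists>Lt. star_shaped_at_0 Lt \<and> L \<subseteq> Lt \<and> (\<forall>\<theta>\<in>S. radial Lt \<theta> = radial_tilde f \<theta>) \<and>
             I \<le> of_nat DIM('a) * beta_b \<alpha> h f * gen_dual_volume G Lt \<and>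
             ((AE \<theta> in sphere_measure. continuous (at \<theta> within S) (f 0) \<and>
                  continuous (at \<theta> within S) (deriv_at_0 f)) \<longrightarrow>
                (AE \<theta> in sphere_measure. continuous (at \<theta> within S) (radial Lt))) \<and>
             (continuous_on S (f 0) \<longrightarrow> continuous_on S (deriv_at_0 f) \<longrightarrow>
                star_body Lt \<and>
                (strict_mono_on {0..} h \<longrightarrow>
                   I = of_nat DIM('a) * beta_b \<alpha> h f * gen_dual_volume G Lt \<longrightarrow> L = Lt)))) \<and>
        (strict_mono_on {0..} h \<longrightarrow> I < \<infinity> \<longrightarrow>
          (I = RB \<longleftrightarrow>
             const_ae_sup (S - Omega f) (f 0) \<and>
             (AE \<theta> in sphere_measure. \<theta> \<notin> Omega f \<longrightarrow>
                radial_tilde f \<theta> = radial L \<theta> \<and> affine_on_ray L f \<theta> \<and>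
                homogeneous_upto G \<alpha> (radial L \<theta>) \<theta>) \<and>
             (AE \<theta> in sphere_measure. \<theta> \<in> Omega f \<longrightarrow>
                (\<forall>r\<in>{0..<radial L \<theta>}. f r \<theta> = f 0 \<theta>)))))"
proof -
  interpret dual_volume_setting h \<alpha> L f G
  proof unfold_locales
    show "compact L" "convex L" using L(1) by (simp_all add: convex_body_def)
    show "continuous_on {0..} h" using h_diff by (rule differentiable_imp_continuous_on)
  qed (fact L(2) f_nonneg f_concave f_meas h_mono h_nonneg G_pos G_cont G_int \<alpha>)+
  have I: "I = (\<integral>\<^sup>+\<theta>. ray_mass \<theta> \<partial>sphere_measure)"
    unfolding I_def by (rule polar_integral_sphere)
  show ?thesis
  proof (intro conjI impI)
    assume G: "\<forall>\<theta>\<in>S. \<forall>r u. r > 0 \<longrightarrow> 0 < u \<longrightarrow> u \<le> 1 \<longrightarrow> G (u * r) \<theta> \<ge> u powr \<alpha> * G r \<theta>"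
    then have G': "\<And>\<theta> r u. \<theta> \<in> sphere 0 1 \<Longrightarrow> r > 0 \<Longrightarrow> 0 < u \<Longrightarrow> u \<le> 1 \<Longrightarrow> G (u * r) \<theta> \<ge> u powr \<alpha> * G r \<theta>"
      unfolding S_def by blast
    show "I \<ge> RA" unfolding I RA_def by (rule lower_bound[OF G'])
    assume h: "strict_mono_on {0..} h"
      and nontriv: "\<not> (AE \<theta> in sphere_measure. \<forall>r\<in>{0..<radial L \<theta>}. f r \<theta> = 0)"
    show "I = RA \<longleftrightarrow> (\<forall>\<theta>\<in>S. homogeneous_upto G \<alpha> (radial L \<theta>) \<theta>) \<and> const_ae_inf S (f 0) \<and>
        (AE \<theta> in sphere_measure. affine_on_ray L f \<theta>)"
      unfolding I RA_def S_def
      using lower_bound_eq_imp[OF G' h nontriv] lower_bound_eq[OF h] by blast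
  next
    assume G: "\<forall>\<theta>\<in>S. \<forall>r u. r > 0 \<longrightarrow> 0 < u \<longrightarrow> u \<le> 1 \<longrightarrow> G (u * r) \<theta> \<le> u powr \<alpha> * G r \<theta>"
    then have G': "\<And>\<theta> r u. \<theta> \<in> sphere 0 1 \<Longrightarrow> r > 0 \<Longrightarrow> 0 < u \<Longrightarrow> u \<le> 1 \<Longrightarrow> G (u * r) \<theta> \<le> u powr \<alpha> * G r \<theta>"
      unfolding S_def by blast
    assume "\<forall>\<theta>\<in>S. \<forall>r\<in>{0..radial L \<theta>}. f r \<theta> \<le> f 0 \<theta>"
    then have f_max: "\<And>\<theta> r. \<theta> \<in> sphere 0 1 \<Longrightarrow> 0 \<le> r \<Longrightarrow> r < radial L \<theta> \<Longrightarrow> f r \<theta> \<le> f 0 \<theta>"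
      unfolding S_def by force
    have RB: "RB = (\<integral>\<^sup>+\<theta>. upper_density \<theta> \<partial>sphere_measure)"
      unfolding RB_def by (rule upper_bound_eq_integral[OF f_max])
    show le: "I \<le> RB" unfolding I RB by (rule upper_bound[OF f_max G'])
    show "\<exists>Lt. star_shaped_at_0 Lt \<and> L \<subseteq> Lt \<and> (\<forall>\<theta>\<in>S. radial Lt \<theta> = radial_tilde f \<theta>) \<and>
             I \<le> of_nat DIM('a) * beta_b \<alpha> h f * gen_dual_volume G Lt \<and>
             ((AE \<theta> in sphere_measure. continuous (at \<theta> within S) (f 0) \<and>
                  continuous (at \<theta> within S) (deriv_at_0 f)) \<longrightarrow>
                (AE \<theta> in sphere_measure. continuous (at \<theta> within S) (radial Lt))) \<and>
             (continuous_on S (f 0) \<longrightarrow> continuous_on S (deriv_at_0 f) \<longrightarrow>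
                star_body Lt \<and>
                (strict_mono_on {0..} h \<longrightarrow>
                   I = of_nat DIM('a) * beta_b \<alpha> h f * gen_dual_volume G Lt \<longrightarrow> L = Lt))"
      if empty: "Omega f = {}"
    proof (intro exI[of _ tilde_body] conjI impI ballI)
      show "star_shaped_at_0 tilde_body" by (rule star_shaped_radial_body)
      show "L \<subseteq> tilde_body" by (rule subset_tilde_body[OF f_max empty])
      show "radial tilde_body \<theta> = radial_tilde f \<theta>" if "\<theta> \<in> S" for \<theta>
        using that radial_tilde_body[OF f_max empty, of \<theta>] unfolding S_def by blast
      have V: "of_nat DIM('a) * beta_b \<alpha> h f * gen_dual_volume G tilde_body = RB"
        unfolding RB by (rule tilde_volume_eq_upper[OF f_max empty])
      show "I \<le> of_nat DIM('a) * beta_b \<alpha> h f * gen_dual_volume G tilde_body"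
        unfolding V by (rule le)
      show "AE \<theta> in sphere_measure. continuous (at \<theta> within S) (radial tilde_body)"
        if "AE \<theta> in sphere_measure. continuous (at \<theta> within S) (f 0) \<and> continuous (at \<theta> within S) (deriv_at_0 f)"
        using that AE_space[of "sphere_measure :: 'a measure"] unfolding S_def
      proof eventually_elim
        case (elim \<theta>)
        then show ?case using continuous_radial_tilde_body[OF f_max empty, of \<theta>] by simp
      qed
      assume cont: "continuous_on S (f 0)" "continuous_on S (deriv_at_0 f)"
      show "star_body tilde_body"
        by (rule star_body_tilde_body[OF f_max empty cont[unfolded S_def]])
      assume h: "strict_mono_on {0..} h"
        and eq: "I = of_nat DIM('a) * beta_b \<alpha> h f * gen_dual_volume G tilde_body"
      show "L = tilde_body"
        by (rule tilde_body_eq[OF f_max G' empty cont[unfolded S_def] h eq[unfolded V, unfolded I RB]])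
    qed
    assume h: "strict_mono_on {0..} h" and I_fin: "I < \<infinity>"
    show "I = RB \<longleftrightarrow>
             const_ae_sup (S - Omega f) (f 0) \<and>
             (AE \<theta> in sphere_measure. \<theta> \<notin> Omega f \<longrightarrow>
                radial_tilde f \<theta> = radial L \<theta> \<and> affine_on_ray L f \<theta> \<and>
                homogeneous_upto G \<alpha> (radial L \<theta>) \<theta>) \<and>
             (AE \<theta> in sphere_measure. \<theta> \<in> Omega f \<longrightarrow>
                (\<forall>r\<in>{0..<radial L \<theta>}. f r \<theta> = f 0 \<theta>))"
      unfolding I RB S_def by (rule upper_bound_eq_iff[OF f_max G' h I_fin[unfolded I]])
  qed
qed

end
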